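(* Let $X$ be a compact metrizable space, let $T:X\to 2^X$ be upper semi-continuous, and let $f:X\to\mathbb{R}$ be upper semi-continuous. Then $$\alpha(f)=\beta(f)=\gamma(f)=\delta(f)=\varepsilon(f)\in[-\infty,+\infty).$$ If, moreover, $X_T\neq\emptyset$ and $f$ is bounded, then $\alpha(f)\in\mathbb{R}$.
   Context: $2^X$ is the set of all subsets of $X$ (the value $T(x)=\emptyset$ is allowed). $T:X\to 2^X$ is upper semi-continuous if for every $x\in X$ and every open $V\supseteq T(x)$ there is an open $U\ni x$ with $T(u)\subseteq V$ for all $u\in U$. For $A\subseteq X$, $T^{-1}(A)=\{x\in X: T(x)\cap A\ne\emptyset\}$. A Borel probability measure $\mu$ on $X$ is $T$-invariant if $\mu(A)\le\mu(T^{-1}(A))$ for all Borel $A\subseteq X$ (the set $T^{-1}(A)$ is analytic, hence universally measurable, so its measure is understood via the completion of $\mu$); $\mathcal{M}_T$ denotes the set of all such measures. The orbit space is $X_T=\{(x_i)_{i\in\mathbb{Z}}\in X^{\mathbb{Z}}: x_{i+1}\in T(x_i)\text{ for all }i\in\mathbb{Z}\}$. For $n\in\mathbb{N}=\{1,2,\dots\}$ let $\mathcal{O}_n(T)=\{(x_0,\dots,x_n)\in X^{n+1}: x_{k+1}\in T(x_k)\text{ for }0\le k\le n-1\}$. Write $S_nf=\sum_{k=0}^n f(x_k)$, both as a function of $(x_0,\dots,x_n)\in\mathcal{O}_n(T)$ and as a function of $\underline{x}=(x_i)_{i\in\mathbb{Z}}\in X_T$. Let $\operatorname{Reg}(T,f)$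 be the set of $\underline{x}\in X_T$ for which $\lim_{n\to+\infty}\frac{1}{n+1}S_nf(\underline{x})$ exists in $[-\infty,\infty]$. With the convention $\sup\emptyset=-\infty$, define $$\alpha(f)=\sup_{\mu\in\mathcal{M}_T}\int f\,d\mu,\qquad \beta(f)=\sup_{\underline{x}\in\operatorname{Reg}(T,f)}\lim_{n\to+\infty}\frac{1}{n+1}S_nf(\underline{x}),$$ $$\gamma(f)=\sup_{\underline{x}\in X_T}\limsup_{n\to+\infty}\frac{1}{n+1}S_nf(\underline{x}),\qquad \delta(f)=\limsup_{n\to+\infty}\frac{1}{n+1}\sup_{(x_0,\dots,x_n)\in\mathcal{O}_n(T)}S_nf(x_0,\dots,x_n),$$ $$\varepsilon(f)=\sup_{\underline{x}\in X_T}\inf_{n\in\mathbb{N}}\frac{1}{n+1}S_nf(\underline{x}).$$ (Integrals of functions bounded above may equal $-\infty$.)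
   Formalization: The values T(x) are assumed closed (possibly empty); for arbitrary subsets the claim fails: X={0}∪{1/n: n≥1}, T(0)={1/n: n≥1}, T(1/n)={1/(n-1)} for n≥2, T(1)=∅, f=0 gives δ(f)=0 but β(f)=-∞. *)

theory Defs
  imports "HOL-Probability.Probability"
begin

text \<open>
  A multivalued map on the space \<open>X\<close> is a function \<open>T :: 'a \<Rightarrow> 'a set\<close>, of which only the values
  on \<open>topspace X\<close> matter; the empty value is allowed. Upper semi-continuity below does not force
  the values to be closed, so closedness has to be assumed separately: without it, orbits of
  every finite length may exist while no infinite orbit does.
\<close>

definition usc_map :: "'a topology \<Rightarrow> ('a \<Rightarrow> 'a set) \<Rightarrow> bool" where
  "usc_map X T \<longleftrightarrow>
    (\<forall>x\<in>topspace X. \<forall>V. openin X V \<and> T x \<subseteq> V \<longrightarrow>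
      (\<exists>U. openin X U \<and> x \<in> U \<and> (\<forall>u\<in>U. T u \<subseteq> V)))"

definition usc_fun :: "'a topology \<Rightarrow> ('a \<Rightarrow> real) \<Rightarrow> bool" where
  "usc_fun X f \<longleftrightarrow> (\<forall>c. openin X {x \<in> topspace X. f x < c})"

definition inv_image_map :: "'a topology \<Rightarrow> ('a \<Rightarrow> 'a set) \<Rightarrow> 'a set \<Rightarrow> 'a set" where
  "inv_image_map X T A = {x \<in> topspace X. T x \<inter> A \<noteq> {}}"

definition borel_prob :: "'a topology \<Rightarrow> 'a measure \<Rightarrow> bool" where
  "borel_prob X M \<longleftrightarrow>
    prob_space M \<and> space M = topspace X \<and> sets M = sigma_sets (topspace X) {U. openin X U}"

text \<open>
  The preimage of a Borel set need not be Borel, so its measure is taken in the completion.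
\<close>

definition invariant_measures :: "'a topology \<Rightarrow> ('a \<Rightarrow> 'a set) \<Rightarrow> 'a measure set" where
  "invariant_measures X T =
    {M. borel_prob X M \<and>
        (\<forall>A\<in>sets M. emeasure M A \<le> emeasure (completion M) (inv_image_map X T A))}"

definition orbit_space :: "'a topology \<Rightarrow> ('a \<Rightarrow> 'a set) \<Rightarrow> (int \<Rightarrow> 'a) set" where
  "orbit_space X T = {x. \<forall>i. x i \<in> topspace X \<and> x (i + 1) \<in> T (x i)}"

definition finite_orbits :: "'a topology \<Rightarrow> ('a \<Rightarrow> 'a set) \<Rightarrow> nat \<Rightarrow> (nat \<Rightarrow> 'a) set" where
  "finite_orbits X T n = {x \<in> {..n} \<rightarrow>\<^sub>E topspace X. \<forall>k<n. x (Suc k) \<in> T (x k)}"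

text \<open>There are \<open>n + 1\<close> summands.\<close>

definition birkhoff_sum :: "('a \<Rightarrow> real) \<Rightarrow> nat \<Rightarrow> (nat \<Rightarrow> 'a) \<Rightarrow> real" where
  "birkhoff_sum f n x = (\<Sum>k\<le>n. f (x k))"

definition birkhoff_avg :: "('a \<Rightarrow> real) \<Rightarrow> (int \<Rightarrow> 'a) \<Rightarrow> nat \<Rightarrow> ereal" where
  "birkhoff_avg f x n = ereal (birkhoff_sum f n (\<lambda>k. x (int k)) / (real n + 1))"

text \<open>Convergence is meant in \<open>ereal\<close>, so the limit may be infinite.\<close>

definition Reg :: "'a topology \<Rightarrow> ('a \<Rightarrow> 'a set) \<Rightarrow> ('a \<Rightarrow> real) \<Rightarrow> (int \<Rightarrow> 'a) set" where
  "Reg X T f = {x \<in> orbit_space X T. convergent (birkhoff_avg f x)}"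

text \<open>
  The integral of a measurable function whose positive part is integrable; the value may be
  \<open>-\<infinity>\<close>, for which the Bochner integral would yield 0.
\<close>

definition ext_integral :: "'a measure \<Rightarrow> ('a \<Rightarrow> real) \<Rightarrow> ereal" where
  "ext_integral M f =
    enn2ereal (\<integral>\<^sup>+x. ennreal (f x) \<partial>M) - enn2ereal (\<integral>\<^sup>+x. ennreal (- f x) \<partial>M)"

definition erg_alpha :: "'a topology \<Rightarrow> ('a \<Rightarrow> 'a set) \<Rightarrow> ('a \<Rightarrow> real) \<Rightarrow> ereal" where
  "erg_alpha X T f = (SUP M\<in>invariant_measures X T. ext_integral M f)"

definition erg_beta :: "'a topology \<Rightarrow> ('a \<Rightarrow> 'a set) \<Rightarrow> ('a \<Rightarrow> real) \<Rightarrow> ereal" where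
  "erg_beta X T f = (SUP x\<in>Reg X T f. lim (birkhoff_avg f x))"

definition erg_gamma :: "'a topology \<Rightarrow> ('a \<Rightarrow> 'a set) \<Rightarrow> ('a \<Rightarrow> real) \<Rightarrow> ereal" where
  "erg_gamma X T f = (SUP x\<in>orbit_space X T. limsup (birkhoff_avg f x))"

definition erg_delta :: "'a topology \<Rightarrow> ('a \<Rightarrow> 'a set) \<Rightarrow> ('a \<Rightarrow> real) \<Rightarrow> ereal" where
  "erg_delta X T f =
    limsup (\<lambda>n. (SUP x\<in>finite_orbits X T n. ereal (birkhoff_sum f n x)) / ereal (real n + 1))"

definition erg_epsilon :: "'a topology \<Rightarrow> ('a \<Rightarrow> 'a set) \<Rightarrow> ('a \<Rightarrow> real) \<Rightarrow> ereal" where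
  "erg_epsilon X T f = (SUP x\<in>orbit_space X T. INF n\<in>{1..}. birkhoff_avg f x n)"

end

theory Submission
  imports Defs
begin

text \<open>
  Write \<open>\<delta>\<close> for \<open>erg_delta X T f\<close>, and similarly for the other
  four quantities. The inequalities \<open>\<beta> \<le> \<gamma>\<close>,
  \<open>\<epsilon> \<le> \<gamma>\<close> and \<open>\<gamma> \<le> \<delta>\<close> are
  immediate, so everything rests on \<open>\<alpha> \<le> \<delta>\<close> and on the fact that
  \<open>\<delta>\<close> is attained in each of the other senses.

  For \<open>\<alpha> \<le> \<delta>\<close> let \<open>h = C - f \<ge> 0\<close> be a cost
  and let \<open>W n x\<close> be the least total cost of an orbit with \<open>n + 1\<close>
  points that starts at \<open>x\<close>; it satisfies
  \<open>W (n + 1) x = h x + (INF y\<in>T x. W n y)\<close>. Invariance of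
  \<open>\<mu>\<close> says that, for every lower semi-continuous \<open>w\<close>, the function
  \<open>x \<mapsto> (INF y\<in>T x. w y)\<close> is stochastically dominated by
  \<open>w\<close>, so
  \<open>\<integral> W n d\<mu> \<le> (n + 1) \<integral> h d\<mu>\<close>, and hence
  \<open>\<integral> f d\<mu>\<close> is at most the largest \<open>n\<close>-th orbit average,
  for every \<open>n\<close> (\<open>ext_integral_le_orbit_average\<close>).

  Conversely let \<open>\<delta> = D\<close> be finite; if
  \<open>\<delta> = -\<infinity>\<close>, there is nothing more to show. Take a long orbit whose
  average exceeds \<open>c\<close>, where \<open>c < D\<close>, and start reading it at a time
  where the partial sums of \<open>f - c\<close> are minimal: from there on every partial sum of
  \<open>f - c\<close> is nonnegative. Letting the length grow and \<open>c\<close> tend to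
  \<open>D\<close>, compactness of the space of two-sided sequences gives one orbit \<open>x\<close>
  all of whose averages are at least \<open>D\<close> (\<open>ex_orbit_large_averages\<close>). This
  yields \<open>D \<le> \<epsilon>\<close>, and since the averages of \<open>x\<close> have limit
  superior at most \<open>\<gamma> \<le> D\<close>, they converge to \<open>D\<close>, which
  yields \<open>D \<le> \<beta>\<close>.

  For \<open>D \<le> \<alpha>\<close> consider the frequencies with which \<open>x\<close> visits
  the subsets of \<open>X\<close>. A pointwise cluster point \<open>\<phi>\<close> of these is a
  finitely additive probability on all subsets with
  \<open>\<phi> A \<le> \<phi> (T\<^sup>-\<^sup>1 A)\<close>, where
  \<open>T\<^sup>-\<^sup>1 A\<close> is \<open>inv_image_map X T A\<close>. Its inner
  regularisation along closed sets is a Borel measure \<open>\<mu>\<close>, with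
  \<open>\<mu> U \<le> \<phi> U\<close> for open \<open>U\<close> and
  \<open>\<phi> K \<le> \<mu> K\<close> for closed \<open>K\<close>, as for a weak limit; so
  \<open>\<integral> f d\<mu> \<ge> D\<close> and
  \<open>\<mu> K \<le> \<mu> (T\<^sup>-\<^sup>1 K)\<close> for closed \<open>K\<close>
  (\<open>ex_invariant_measure_from_orbit\<close>). To pass from closed to Borel sets
  \<open>A\<close>, note that \<open>T\<^sup>-\<^sup>1 A\<close> is in general only analytic;
  Choquet's capacitability argument shows that analytic sets are measurable for the completion of
  \<open>\<mu>\<close> (\<open>analytic_in_completion\<close>) and that \<open>A\<close> is
  exhausted by closed sets.
\<close>

section \<open>Analytic sets and universal measurability\<close>

abbreviation baire :: "(nat \<Rightarrow> nat) topology" where "baire \<equiv> euclidean"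

text \<open>
  Analytic sets as projections of closed subsets of \<open>X \<times> \<nat>\<^sup>\<nat>\<close>.
  With this encoding countable unions and intersections amount to a reindexing of sequences.
\<close>

definition analytic_in :: "'a topology \<Rightarrow> 'a set \<Rightarrow> bool" where
  "analytic_in X S \<longleftrightarrow> (\<exists>P. closedin (prod_topology X baire) P \<and> S = fst ` P)"

lemma analytic_in_subset: "analytic_in X S \<Longrightarrow> S \<subseteq> topspace X"
  unfolding analytic_in_def by (force dest: closedin_subset)

lemma analytic_in_closedin:
  assumes "closedin X S" shows "analytic_in X S"
  unfolding analytic_in_def
proof (intro exI conjI)
  show "closedin (prod_topology X baire) (S \<times> UNIV)"
    using assms by (simp add: closedin_prod_Times_iff)
qed auto

lemma continuous_map_prod_baire:
  assumes "continuous_on UNIV \<phi>"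
  shows "continuous_map (prod_topology X baire) (prod_topology X baire) (\<lambda>p. (fst p, \<phi> (snd p)))"
proof -
  have "continuous_map (prod_topology X baire) baire (\<phi> \<circ> snd)"
    by (rule continuous_map_compose[OF continuous_map_snd]) (use assms in simp)
  then show ?thesis
    by (simp add: continuous_map_pairwise o_def continuous_map_fst)
qed

lemma continuous_reindex: "continuous_on UNIV (\<lambda>\<sigma>::nat \<Rightarrow> nat. \<lambda>k::nat. \<sigma> (r k))"
  by (intro continuous_on_coordinatewise_then_product continuous_on_product_coordinates)

text \<open>
  The first entry of a sequence selects the set of the union, the remaining entries are a witness
  for membership in it.
\<close>

lemma analytic_in_UN:
  fixes A :: "nat \<Rightarrow> 'a set"
  assumes "\<And>n. analytic_in X (A n)"
  shows "analytic_in X (\<Union>n. A n)"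
proof -
  obtain P where P: "\<And>n. closedin (prod_topology X baire) (P n)" "\<And>n. A n = fst ` P n"
    using assms unfolding analytic_in_def by metis
  let ?Y = "prod_topology X baire"
  let ?s = "\<lambda>p::'a \<times> (nat \<Rightarrow> nat). (fst p, \<lambda>k. snd p (Suc k))"
  define Q where "Q = {p \<in> topspace ?Y. ?s p \<in> P (snd p 0)}"
  have s: "continuous_map ?Y ?Y ?s"
    by (rule continuous_map_prod_baire[OF continuous_reindex])
  have op: "openin ?Y ({p \<in> topspace ?Y. snd p \<in> {\<sigma>. \<sigma> 0 = n}} \<inter> {p \<in> topspace ?Y. ?s p \<in> topspace ?Y - P n})" for n :: nat
  proof (intro openin_Int openin_continuous_map_preimage)
    show "continuous_map ?Y baire snd" by (rule continuous_map_snd)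
    have "open {n}" by (rule Topological_Spaces.open_discrete)
    then have "open ((\<lambda>\<sigma>::nat \<Rightarrow> nat. \<sigma> 0) -` {n})"
      by (rule open_vimage) (rule continuous_on_product_coordinates)
    then show "openin baire {\<sigma>. \<sigma> 0 = n}" by (simp add: vimage_def)
    show "openin ?Y (topspace ?Y - P n)" using P by blast
  qed (rule s)
  have "topspace ?Y - Q = (\<Union>n. {p \<in> topspace ?Y. snd p \<in> {\<sigma>. \<sigma> 0 = n}} \<inter> {p \<in> topspace ?Y. ?s p \<in> topspace ?Y - P n})"
    unfolding Q_def by auto
  then have "openin ?Y (topspace ?Y - Q)"
    using op by (metis (no_types, lifting) openin_clauses(3) imageE)
  then have clo: "closedin ?Y Q"
    by (simp add: closedin_def Q_def)
  have "fst ` Q = (\<Union>n. A n)"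
  proof
    show "fst ` Q \<subseteq> (\<Union>n. A n)"
      unfolding P Q_def by force
    show "(\<Union>n. A n) \<subseteq> fst ` Q"
    proof
      fix x assume "x \<in> (\<Union>n. A n)"
      then obtain n \<sigma> where n: "(x,\<sigma>) \<in> P n"
        unfolding P by auto
      then have "x \<in> topspace X" using closedin_subset[OF P(1)[of n]] by auto
      then have "(x, case_nat n \<sigma>) \<in> Q"
        using n by (simp add: Q_def)
      then show "x \<in> fst ` Q" by force
    qed
  qed
  then show ?thesis
    unfolding analytic_in_def using clo by metis
qed

text \<open>
  A sequence of naturals encodes, through the pairing function, one witness for each member of the
  intersection.
\<close>

lemma analytic_in_INT:
  fixes A :: "nat \<Rightarrow> 'a set"
  assumes "\<And>n. analytic_in X (A n)"
  shows "analytic_in X (\<Inter>n. A n)"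
proof -
  obtain P where P: "\<And>n. closedin (prod_topology X baire) (P n)" "\<And>n. A n = fst ` P n"
    using assms unfolding analytic_in_def by metis
  let ?Y = "prod_topology X baire"
  let ?s = "\<lambda>n. \<lambda>p::'a \<times> (nat \<Rightarrow> nat). (fst p, \<lambda>k. snd p (prod_encode (n,k)))"
  define Q where "Q = (\<Inter>n. {p \<in> topspace ?Y. ?s n p \<in> P n})"
  have clo: "closedin ?Y Q"
    unfolding Q_def
    by (intro closedin_INT closedin_continuous_map_preimage[OF continuous_map_prod_baire[OF continuous_reindex] P(1)]) simp
  have "fst ` Q = (\<Inter>n. A n)"
  proof
    show "fst ` Q \<subseteq> (\<Inter>n. A n)"
      unfolding P Q_def by force
    show "(\<Inter>n. A n) \<subseteq> fst ` Q"
    proof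
      fix x assume "x \<in> (\<Inter>n. A n)"
      then have "\<forall>n. \<exists>\<sigma>. (x,\<sigma>) \<in> P n" unfolding P by (force simp: image_iff)
      then obtain \<sigma> where s: "\<And>n. (x,\<sigma> n) \<in> P n" by metis
      then have "x \<in> topspace X" using closedin_subset[OF P(1)[of 0]] by auto
      then have "(x, \<lambda>j. \<sigma> (fst (prod_decode j)) (snd (prod_decode j))) \<in> Q"
        using s by (simp add: Q_def)
      then show "x \<in> fst ` Q" by force
    qed
  qed
  then show ?thesis
    unfolding analytic_in_def using clo by metis
qed

text \<open>
  The sets that are analytic together with their complement form a \<open>\<sigma>\<close>-algebra;
  it contains the open sets because these are countable unions of closed sets.
\<close>

lemma analytic_in_borel:
  assumes X: "metrizable_space X"
    and A: "A \<in> sigma_sets (topspace X) {U. openin X U}"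
  shows "analytic_in X A"
proof -
  have op: "analytic_in X U" if "openin X U" for U
  proof -
    obtain C :: "nat \<Rightarrow> 'a set" where "\<forall>n. closedin X (C n)" "\<Union> (range C) = U"
      using open_imp_fsigma_in[OF X \<open>openin X U\<close>] unfolding fsigma_in_ascending by auto
    then show ?thesis using analytic_in_UN[of X C] analytic_in_closedin[of X] by auto
  qed
  have "analytic_in X A \<and> analytic_in X (topspace X - A)"
    using A
  proof (induction rule: sigma_sets.induct)
    case (Basic U)
    then have "openin X U" by simp
    then show ?case using op analytic_in_closedin[of X "topspace X - U"] by auto
  next
    case Empty
    then show ?case by (simp add: analytic_in_closedin)
  next
    case (Compl a)
    then show ?case
      by (simp add: double_diff analytic_in_subset)
  next
    case (Union a)
    have "topspace X - (\<Union>i. a i) = (\<Inter>i. topspace X - a i)" by auto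
    then show ?case using Union analytic_in_UN[of X a] analytic_in_INT[of X "\<lambda>i. topspace X - a i"] by simp
  qed
  then show ?thesis ..
qed

lemma tendsto_fun_iff:
  fixes f :: "'c \<Rightarrow> 'i \<Rightarrow> 'b::topological_space"
  shows "(f \<longlongrightarrow> l) F \<longleftrightarrow> (\<forall>i. ((\<lambda>x. f x i) \<longlongrightarrow> l i) F)"
  using limitin_componentwise[of "\<lambda>_. euclidean" UNIV f l F]
  by (simp add: euclidean_product_topology)

lemma diagonal_sequence_in_closures:
  assumes "metrizable_space X" "x \<in> topspace X"
    and "\<And>k::nat. x \<in> X closure_of (A k)"
  obtains u where "limitin X u x sequentially" "\<And>k. u k \<in> A k"
proof -
  obtain M d where M: "Metric_space M d" and X: "X = Metric_space.mtopology M d"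
    using assms(1) unfolding metrizable_space_def by blast
  interpret Metric_space M d by (rule M)
  have "\<exists>y\<in>A k. y \<in> mball x (1 / (real k + 1))" for k
    using assms(3)[of k] unfolding X metric_closure_of by auto
  then obtain u where u: "\<And>k. u k \<in> A k" "\<And>k. u k \<in> mball x (1 / (real k + 1))"
    by metis
  have "limitin X u x sequentially"
    unfolding X limitin_metric
  proof (intro conjI allI impI)
    show "x \<in> M" using assms(2) by (simp add: X)
    fix \<epsilon> :: real assume "\<epsilon> > 0"
    then have "\<forall>\<^sub>F k in sequentially. 1 / (real k + 1) < \<epsilon>"
      by real_asymp
    then show "\<forall>\<^sub>F k in sequentially. u k \<in> M \<and> d (u k) x < \<epsilon>"
    proof eventually_elim
      case (elim k)
      then show ?case using u(2)[of k] by (auto simp: commute)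
    qed
  qed
  with u that show ?thesis by blast
qed

lemma borel_prob_closedin:
  assumes "borel_prob X M" "closedin X K" shows "K \<in> sets M"
proof -
  have "topspace X - (topspace X - K) \<in> sigma_sets (topspace X) {U. openin X U}"
    using assms(2) by (intro sigma_sets.Compl sigma_sets.Basic) auto
  moreover have "topspace X - (topspace X - K) = K"
    using closedin_subset[OF assms(2)] by blast
  ultimately show ?thesis using assms by (simp add: borel_prob_def)
qed

text \<open>
  Choquet's capacitability theorem for the outer measure of \<open>M\<close>. Let \<open>P\<close>
  be the closed set that projects onto \<open>S\<close>, and cut \<open>P\<close> down successively
  by bounds on the entries of the second component. Since outer measure is continuous along
  increasing unions of arbitrary sets, the bounds \<open>m 0, m 1, \<dots>\<close> can be chosen
  such that the outer measure stays above \<open>r\<close>. The sequences below \<open>m\<close>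
  form a compact set, so the intersection of the closures of the successive projections still
  consists of projections of points of \<open>P\<close>.
\<close>

lemma analytic_in_capacitable:
  assumes X: "compact_space X" "metrizable_space X" and M: "borel_prob X M"
    and S: "analytic_in X S" and r: "r < outer_measure_of M S"
  obtains K where "closedin X K" "K \<subseteq> S" "r \<le> emeasure M K"
proof -
  interpret prob_space M using M by (simp add: borel_prob_def)
  obtain P where P: "closedin (prod_topology X baire) P" "S = fst ` P"
    using S unfolding analytic_in_def by metis
  have PX: "P \<subseteq> topspace X \<times> UNIV" using closedin_subset[OF P(1)] by simp
  have sp: "space M = topspace X" using M by (simp add: borel_prob_def)
  define Q where "Q m k = fst ` {p \<in> P. \<forall>i<k. snd p i \<le> m i}" for m :: "nat \<Rightarrow> nat" and k
  have QX: "Q m k \<subseteq> topspace X" for m k using PX by (auto simp: Q_def)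
  have step: "\<exists>m'. r < outer_measure_of M (Q m' (Suc k)) \<and> (\<forall>i<k. m' i = m i)"
    if "r < outer_measure_of M (Q m k)" for m k
  proof -
    have "Q m k = (\<Union>j. Q (m(k:=j)) (Suc k))"
    proof -
      have "\<exists>j. \<forall>i<Suc k. \<sigma> i \<le> (m(k:=j)) i" if "\<forall>i<k. \<sigma> i \<le> m i" for \<sigma>
        using that by (intro exI[of _ "\<sigma> k"]) (auto simp: less_Suc_eq)
      moreover have "\<forall>i<k. \<sigma> i \<le> m i" if "\<forall>i<Suc k. \<sigma> i \<le> (m(k:=j)) i" for \<sigma> j
        using that by (metis fun_upd_apply less_Suc_eq nat_neq_iff)
      ultimately have "(\<forall>i<k. \<sigma> i \<le> m i) \<longleftrightarrow> (\<exists>j. \<forall>i<Suc k. \<sigma> i \<le> (m(k:=j)) i)" for \<sigma>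
        by metis
      then have "{p \<in> P. \<forall>i<k. snd p i \<le> m i} = (\<Union>j. {p \<in> P. \<forall>i<Suc k. snd p i \<le> (m(k:=j)) i})"
        by (simp add: set_eq_iff)
      then show ?thesis unfolding Q_def by (simp add: image_UN)
    qed
    also have "outer_measure_of M \<dots> = (SUP j. outer_measure_of M (Q (m(k:=j)) (Suc k)))"
    proof (rule SUP_outer_measure_of_incseq[symmetric])
      show "Q (m(k := j)) (Suc k) \<subseteq> space M" for j using QX sp by simp
      show "incseq (\<lambda>j. Q (m(k := j)) (Suc k))"
        unfolding incseq_def Q_def by (intro allI impI image_mono) (fastforce simp: less_Suc_eq)
    qed
    finally show ?thesis
      using that by (fastforce simp: less_SUP_iff)
  qed
  have "\<exists>g. \<forall>k. r < outer_measure_of M (Q (g k) k) \<and> (\<forall>i<k. g (Suc k) i = g k i)"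
  proof (rule dependent_nat_choice)
    show "\<exists>m. r < outer_measure_of M (Q m 0)"
      using r P(2) by (simp add: Q_def)
  qed (use step in blast)
  then obtain g where g: "\<And>k. r < outer_measure_of M (Q (g k) k)" "\<And>k i. i < k \<Longrightarrow> g (Suc k) i = g k i"
    by blast
  define m where "m i = g (Suc i) i" for i
  have gm: "g k i = m i" if "i < k" for i k
    using that by (induction k) (auto simp: m_def g(2) less_Suc_eq)
  have Qm: "r < outer_measure_of M (Q m k)" for k
  proof -
    have "Q m k = Q (g k) k" unfolding Q_def by (simp add: gm)
    then show ?thesis using g(1) by simp
  qed
  let ?K = "\<Inter>k. X closure_of (Q m k)"
  have clo: "closedin X ?K" by auto
  have "?K \<subseteq> S"
  proof
    fix x assume x: "x \<in> ?K"
    then have xX: "x \<in> topspace X" using closure_of_subset_topspace[of X] by blast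
    obtain u where u: "limitin X u x sequentially" "\<And>k. u k \<in> Q m k"
      using diagonal_sequence_in_closures[OF X(2) xX] x by blast
    then have "\<forall>k. \<exists>\<sigma>. (u k,\<sigma>) \<in> P \<and> (\<forall>i<k. \<sigma> i \<le> m i)"
      unfolding Q_def by force
    then obtain s where s: "\<And>k. (u k, s k) \<in> P" "\<And>k i. i < k \<Longrightarrow> s k i \<le> m i"
      by metis
    \<comment> \<open>The witnesses \<open>s k\<close> obey the bounds only in their first \<open>k\<close> entries; truncation moves them into a compact set without changing any entry in the long run.\<close>
    define t where "t k i = min (s k i) (m i)" for k i
    have "compactin (product_topology (\<lambda>i. euclidean) UNIV) (PiE UNIV (\<lambda>i. {..m i}))"
      by (subst compactin_PiE) (simp add: finite_imp_compact)
    then have "compact (PiE UNIV (\<lambda>i. {..m i}))"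
      by (simp add: euclidean_product_topology)
    then have "seq_compact (PiE UNIV (\<lambda>i. {..m i}))"
      by (rule compact_imp_seq_compact)
    then obtain \<tau> l where l: "strict_mono (l::nat\<Rightarrow>nat)" "(t \<circ> l) \<longlonglongrightarrow> \<tau>"
      unfolding seq_compact_def by (metis (no_types, lifting) PiE_UNIV_domain Pi_I atMost_iff min.cobounded2 t_def)
    have "(s \<circ> l) \<longlonglongrightarrow> \<tau>"
      unfolding tendsto_fun_iff
    proof
      fix i
      have "((\<lambda>k. (t \<circ> l) k i) \<longlongrightarrow> \<tau> i) sequentially"
        using l(2) by (simp add: tendsto_fun_iff)
      moreover have "\<forall>\<^sub>F k in sequentially. (t \<circ> l) k i = (s \<circ> l) k i"
        using eventually_gt_at_top[of i]
      proof eventually_elim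
        case (elim k)
        then have "i < l k" using seq_suble[OF l(1), of k] by simp
        then show ?case using s(2)[of i "l k"] by (simp add: t_def)
      qed
      ultimately show "((\<lambda>k. (s \<circ> l) k i) \<longlongrightarrow> \<tau> i) sequentially"
        by (rule Lim_transform_eventually)
    qed
    moreover have "limitin X (u \<circ> l) x sequentially"
      by (rule limitin_subsequence[OF l(1) u(1)])
    ultimately have "limitin (prod_topology X baire) (\<lambda>k. (u (l k), s (l k))) (x, \<tau>) sequentially"
      by (simp add: limitin_pairwise o_def)
    then have "(x,\<tau>) \<in> P"
      using limitin_closedin[OF _ P(1)] s(1) by fastforce
    then show "x \<in> S" using P(2) by force
  qed
  moreover have "r \<le> emeasure M ?K"
  proof -
    have cm: "X closure_of (Q m k) \<in> sets M" for k
      using borel_prob_closedin[OF M] by simp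
    have "decseq (\<lambda>k. X closure_of (Q m k))"
      unfolding decseq_def Q_def by (intro allI impI closure_of_mono image_mono) auto
    then have "emeasure M ?K = (INF k. emeasure M (X closure_of (Q m k)))"
      using cm by (intro INF_emeasure_decseq[symmetric]) auto
    also have "r \<le> \<dots>"
    proof (rule INF_greatest)
      fix k
      have "r \<le> outer_measure_of M (Q m k)" using Qm by (simp add: less_imp_le)
      also have "\<dots> \<le> outer_measure_of M (X closure_of (Q m k))"
        by (intro outer_measure_of_mono closure_of_subset QX)
      finally show "r \<le> emeasure M (X closure_of (Q m k))" using cm by simp
    qed
    finally show ?thesis .
  qed
  ultimately show ?thesis using that clo by blast
qed

text \<open>
  A measurable hull \<open>B\<close> of \<open>S\<close> and a countable union
  \<open>L \<subseteq> S\<close> of closed sets that exhaust the outer measure of \<open>S\<close>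
  differ by a null set.
\<close>

lemma analytic_in_completion:
  assumes X: "compact_space X" "metrizable_space X" and M: "borel_prob X M"
    and S: "analytic_in X S"
  shows "S \<in> sets (completion M)"
proof -
  interpret prob_space M using M by (simp add: borel_prob_def)
  have sp: "space M = topspace X" using M by (simp add: borel_prob_def)
  obtain B where B: "B \<in> sets M" "S \<subseteq> B" "outer_measure_of M S = emeasure M B"
    using outer_measure_of_attain[of S M] analytic_in_subset[OF S] sp by metis
  have fin: "emeasure M B < \<infinity>" by (simp add: less_top[symmetric])
  have "\<exists>L\<in>sets M. L \<subseteq> S \<and> emeasure M L = emeasure M B"
  proof (cases "emeasure M B = 0")
    case True
    then show ?thesis by (intro bexI[of _ "{}"]) auto
  next
    case False
    have "\<exists>K. K \<in> sets M \<and> K \<subseteq> S \<and> emeasure M B - ennreal (1 / Suc n) \<le> emeasure M K" for n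
    proof -
      have "emeasure M B - ennreal (1 / Suc n) < outer_measure_of M S"
        unfolding B(3) using False fin
        by (intro ennreal_between) (auto simp: zero_less_iff_neq_zero)
      then show ?thesis using analytic_in_capacitable[OF X M S] borel_prob_closedin[OF M] by metis
    qed
    then obtain K where K: "\<And>n. K n \<in> sets M" "\<And>n. K n \<subseteq> S" "\<And>n. emeasure M B - ennreal (1 / Suc n) \<le> emeasure M (K n)"
      by metis
    let ?L = "\<Union>n. K n"
    have "emeasure M B \<le> emeasure M ?L"
    proof (rule ennreal_le_epsilon)
      fix e :: real assume "0 < e"
      then obtain n where n: "1 / Suc n < e" using nat_approx_posE by metis
      have "emeasure M B \<le> emeasure M (K n) + ennreal (1 / Suc n)"
        using K(3)[of n] by (simp add: ennreal_minus_le_iff add.commute)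
      also have "\<dots> \<le> emeasure M ?L + ennreal e"
        using n K(1) by (intro add_mono emeasure_mono ennreal_leI) auto
      finally show "emeasure M B \<le> emeasure M ?L + ennreal e" .
    qed
    moreover have "emeasure M ?L \<le> emeasure M B"
      using K(2) B by (intro emeasure_mono) blast+
    ultimately show ?thesis using K by (intro bexI[of _ ?L]) (auto intro: antisym)
  qed
  then obtain L where L: "L \<in> sets M" "L \<subseteq> S" "emeasure M L = emeasure M B" by blast
  have null: "B - L \<in> null_sets M"
    using L B by (auto simp: null_sets_def emeasure_Diff)
  show ?thesis
    by (rule sets_completionI[of S L "S - L" "B - L"]) (use L B null in auto)
qed

section \<open>Relations with closed graph on a compact metrizable space\<close>

text \<open>
  A set-valued map with these properties is the same thing as a closed relation: its graph is
  closed, and on a compact space this makes images and preimages of closed sets closed.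
\<close>

locale compact_relation =
  fixes X :: "'a topology" and T :: "'a \<Rightarrow> 'a set"
  assumes compact: "compact_space X" and metrizable: "metrizable_space X"
    and closed_values: "\<forall>x\<in>topspace X. closedin X (T x)"
    and usc: "usc_map X T"
begin

lemma value_subset: "x \<in> topspace X \<Longrightarrow> T x \<subseteq> topspace X"
  using closed_values closedin_subset by blast

definition graph :: "('a \<times> 'a) set" where
  "graph = {(x, y). x \<in> topspace X \<and> y \<in> T x}"

lemma closedin_graph: "closedin (prod_topology X X) graph"
proof -
  have "openin (prod_topology X X) (topspace (prod_topology X X) - graph)"
  proof (subst openin_subopen, intro ballI)
    fix p assume "p \<in> topspace (prod_topology X X) - graph"
    then obtain x y where p: "p = (x,y)" "x \<in> topspace X" "y \<in> topspace X" "y \<notin> T x"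
      by (auto simp: graph_def)
    have cl: "closedin X (T x)" using closed_values p by blast
    have "normal_space X" "t1_space X"
      using metrizable metrizable_imp_normal_space metrizable_imp_t1_space by blast+
    moreover have "closedin X {y}"
      using \<open>t1_space X\<close> p(3) by (simp add: closedin_t1_singleton)
    moreover have "disjnt (T x) {y}" using p by (simp add: disjnt_def)
    ultimately obtain V W where VW: "openin X V" "openin X W" "T x \<subseteq> V" "{y} \<subseteq> W" "disjnt V W"
      using cl unfolding normal_space_def by meson
    obtain U where U: "openin X U" "x \<in> U" "\<forall>u\<in>U. T u \<subseteq> V"
      using usc VW(1,3) p(2) unfolding usc_map_def by meson
    have "openin (prod_topology X X) (U \<times> W)"
      using U VW by (simp add: openin_prod_Times_iff)
    moreover have "p \<in> U \<times> W" using p U VW by auto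
    moreover have "U \<times> W \<subseteq> topspace (prod_topology X X) - graph"
      using U VW openin_subset[OF U(1)] openin_subset[OF VW(2)]
      unfolding graph_def disjnt_def by auto
    ultimately show "\<exists>N. openin (prod_topology X X) N \<and> p \<in> N \<and> N \<subseteq> topspace (prod_topology X X) - graph"
      by blast
  qed
  moreover have "graph \<subseteq> topspace (prod_topology X X)"
    using value_subset by (auto simp: graph_def)
  ultimately show ?thesis by (simp add: closedin_def)
qed

lemma closedin_inv_image:
  assumes "closedin X K" shows "closedin X (inv_image_map X T K)"
proof -
  have "closedin (prod_topology X X) (graph \<inter> topspace X \<times> K)"
    using closedin_graph assms by (intro closedin_Int) (simp_all add: closedin_prod_Times_iff)
  then have "closedin X (fst ` (graph \<inter> topspace X \<times> K))"
    using closed_map_fst[OF compact, of X] unfolding closed_map_def by blast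
  moreover have "fst ` (graph \<inter> topspace X \<times> K) = inv_image_map X T K"
    unfolding graph_def inv_image_map_def by force
  ultimately show ?thesis by simp
qed

lemma closedin_image:
  assumes "closedin X K" shows "closedin X (\<Union>x\<in>K. T x)"
proof -
  have "closedin (prod_topology X X) (graph \<inter> K \<times> topspace X)"
    using closedin_graph assms by (intro closedin_Int) (simp_all add: closedin_prod_Times_iff)
  then have "closedin X (snd ` (graph \<inter> K \<times> topspace X))"
    using closed_map_snd[OF compact, of X] unfolding closed_map_def by blast
  moreover have "snd ` (graph \<inter> K \<times> topspace X) = (\<Union>x\<in>K. T x)"
    using closedin_subset[OF assms] value_subset unfolding graph_def by force
  ultimately show ?thesis by simp
qed

text \<open>
  Upper semi-continuity for preimages: if \<open>T\<^sup>-\<^sup>1 K \<subseteq> U\<close>, then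
  the image of the complement of \<open>U\<close> is a closed set disjoint from \<open>K\<close>,
  and normality separates the two. This replaces the continuity of a map when inequalities pass to a
  limit of measures.
\<close>

lemma inv_image_neighbourhood:
  assumes "closedin X K" "openin X U" "inv_image_map X T K \<subseteq> U"
  obtains V where "openin X V" "K \<subseteq> V" "inv_image_map X T (X closure_of V) \<subseteq> U"
proof -
  let ?W = "topspace X - U"
  have W: "closedin X (\<Union>x\<in>?W. T x)"
    using assms by (intro closedin_image) auto
  have "K \<subseteq> topspace X - (\<Union>x\<in>?W. T x)"
    using assms(3) closedin_subset[OF assms(1)] unfolding inv_image_map_def by blast
  moreover have "normal_space X" using metrizable metrizable_imp_normal_space by blast
  ultimately obtain V where V: "openin X V" "K \<subseteq> V" "X closure_of V \<subseteq> topspace X - (\<Union>x\<in>?W. T x)"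
    using W assms(1) unfolding normal_space_alt by (meson openin_diff openin_topspace)
  then have "inv_image_map X T (X closure_of V) \<subseteq> U"
    unfolding inv_image_map_def by blast
  with V that show ?thesis by blast
qed

text \<open>
  If \<open>A\<close> is the projection of \<open>P\<close>, then the preimage is the projection of
  the set of all \<open>(x, y, \<sigma>)\<close> with \<open>y \<in> T x\<close> and
  \<open>(y, \<sigma>) \<in> P\<close>. The coordinate \<open>y\<close> ranges over a compact
  space, so projecting it away keeps the set closed.
\<close>

lemma analytic_in_inv_image:
  assumes "analytic_in X A" shows "analytic_in X (inv_image_map X T A)"
proof -
  obtain P where P: "closedin (prod_topology X baire) P" "A = fst ` P"
    using assms unfolding analytic_in_def by metis
  let ?Y = "prod_topology X baire"
  let ?Z = "prod_topology ?Y X"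
  have "continuous_map ?Z X (fst \<circ> fst)" "continuous_map ?Z baire (snd \<circ> fst)"
    by (rule continuous_map_compose[OF continuous_map_fst continuous_map_fst])
      (rule continuous_map_compose[OF continuous_map_fst continuous_map_snd])
  then have 1: "continuous_map ?Z (prod_topology X X) (\<lambda>q. (fst (fst q), snd q))"
    and 2: "continuous_map ?Z ?Y (\<lambda>q. (snd q, snd (fst q)))"
    by (simp_all add: continuous_map_pairwise o_def continuous_map_snd)
  define R where "R = {q \<in> topspace ?Z. (fst (fst q), snd q) \<in> graph} \<inter> {q \<in> topspace ?Z. (snd q, snd (fst q)) \<in> P}"
  have "closedin ?Z R"
    unfolding R_def
    by (intro closedin_Int closedin_continuous_map_preimage[OF 1 closedin_graph] closedin_continuous_map_preimage[OF 2 P(1)])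
  then have clo: "closedin ?Y (fst ` R)"
    using closed_map_fst[OF compact, of ?Y] unfolding closed_map_def by blast
  have "fst ` (fst ` R) = inv_image_map X T A"
  proof
    show "fst ` (fst ` R) \<subseteq> inv_image_map X T A"
      unfolding R_def graph_def inv_image_map_def P(2) by force
    show "inv_image_map X T A \<subseteq> fst ` (fst ` R)"
    proof
      fix x assume "x \<in> inv_image_map X T A"
      then obtain y \<sigma> where "x \<in> topspace X" "y \<in> T x" "(y,\<sigma>) \<in> P"
        unfolding inv_image_map_def P(2) by auto
      then have "((x,\<sigma>),y) \<in> R"
        using value_subset by (auto simp: R_def graph_def)
      then show "x \<in> fst ` (fst ` R)" by force
    qed
  qed
  with clo show ?thesis unfolding analytic_in_def by metis
qed

lemma invariant_if_invariant_on_closed: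
  assumes M: "borel_prob X M"
    and K: "\<And>K. closedin X K \<Longrightarrow> emeasure M K \<le> emeasure M (inv_image_map X T K)"
  shows "M \<in> invariant_measures X T"
proof -
  have "emeasure M A \<le> emeasure (completion M) (inv_image_map X T A)" if A: "A \<in> sets M" for A
  proof (rule dense_le)
    fix r assume "r < emeasure M A"
    moreover have an: "analytic_in X A"
      using A M analytic_in_borel[OF metrizable] by (simp add: borel_prob_def)
    ultimately obtain L where L: "closedin X L" "L \<subseteq> A" "r \<le> emeasure M L"
      using analytic_in_capacitable[OF compact metrizable M an] A by auto
    have "r \<le> emeasure M (inv_image_map X T L)"
      using L(3) K[OF L(1)] by (rule order_trans)
    also have "\<dots> = emeasure (completion M) (inv_image_map X T L)"
      using borel_prob_closedin[OF M closedin_inv_image[OF L(1)]] by simp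
    also have "\<dots> \<le> emeasure (completion M) (inv_image_map X T A)"
    proof (rule emeasure_mono)
      show "inv_image_map X T L \<subseteq> inv_image_map X T A"
        using L(2) by (auto simp: inv_image_map_def)
      show "inv_image_map X T A \<in> sets (completion M)"
        by (rule analytic_in_completion[OF compact metrizable M analytic_in_inv_image[OF an]])
    qed
    finally show "r \<le> emeasure (completion M) (inv_image_map X T A)" .
  qed
  with M show ?thesis by (simp add: invariant_measures_def)
qed

lemma invariant_on_closed:
  assumes M: "M \<in> invariant_measures X T" and K: "closedin X K"
  shows "emeasure M K \<le> emeasure M (inv_image_map X T K)"
proof -
  have "borel_prob X M" using M by (simp add: invariant_measures_def)
  then show ?thesis
    using M borel_prob_closedin[of X M, OF _ K] borel_prob_closedin[of X M, OF _ closedin_inv_image[OF K]]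
    by (auto simp: invariant_measures_def)
qed

end

section \<open>Comparing integrals through their tails\<close>

text \<open>
  The step function with steps of height \<open>\<epsilon>\<close> that lies just below
  \<open>h\<close>. It replaces the layer-cake integral by finite sums of measures of strict
  superlevel sets, and such sums are compatible with pointwise limits of set functions.
\<close>

lemma staircase_le:
  fixes \<epsilon> h :: real
  assumes "0 < \<epsilon>" "0 \<le> h"
  shows "(\<Sum>k<N. if \<epsilon> * real (Suc k) < h then \<epsilon> else 0) \<le> h"
proof (induction N)
  case (Suc N)
  show ?case
  proof (cases "\<epsilon> * real (Suc N) < h")
    case True
    have "(\<Sum>k<Suc N. if \<epsilon> * real (Suc k) < h then \<epsilon> else 0) \<le> (\<Sum>k<Suc N. \<epsilon>)"
      using assms by (intro sum_mono) auto
    also have "\<dots> = \<epsilon> * real (Suc N)" by simp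
    finally show ?thesis using True by linarith
  qed (use Suc in simp)
qed (use assms in simp)

lemma staircase_le_ennreal:
  fixes h :: ennreal
  assumes "0 < \<epsilon>"
  shows "(\<Sum>k<N. if ennreal (\<epsilon> * real (Suc k)) < h then ennreal \<epsilon> else 0) \<le> h"
proof (cases h)
  case (real r)
  have "(\<Sum>k<N. if ennreal (\<epsilon> * real (Suc k)) < h then ennreal \<epsilon> else 0)
      = (\<Sum>k<N. ennreal (if \<epsilon> * real (Suc k) < r then \<epsilon> else 0))"
    using assms real by (intro sum.cong) (auto simp: ennreal_less_iff)
  also have "\<dots> = ennreal (\<Sum>k<N. if \<epsilon> * real (Suc k) < r then \<epsilon> else 0)"
    using assms by (intro sum_ennreal) auto
  also have "\<dots> \<le> ennreal r"
    using assms real staircase_le by (intro ennreal_leI) auto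
  finally show ?thesis using real by simp
qed simp

lemma le_staircase_ennreal:
  fixes h :: ennreal
  assumes "0 < \<epsilon>"
  shows "h \<le> ennreal \<epsilon> + (\<Sum>k. if ennreal (\<epsilon> * real (Suc k)) < h then ennreal \<epsilon> else 0)"
    (is "_ \<le> _ + suminf ?s")
proof (cases "\<exists>n. h \<le> ennreal (\<epsilon> * real (Suc n))")
  case True
  define n where "n = (LEAST n. h \<le> ennreal (\<epsilon> * real (Suc n)))"
  have n: "h \<le> ennreal (\<epsilon> * real (Suc n))"
    unfolding n_def using True by (rule LeastI_ex)
  have "ennreal (\<epsilon> * real (Suc k)) < h" if "k < n" for k
    using not_less_Least[of k "\<lambda>n. h \<le> ennreal (\<epsilon> * real (Suc n))"] that
    unfolding n_def by (simp add: not_le)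
  then have "(\<Sum>k<n. ?s k) = (\<Sum>k<n. ennreal \<epsilon>)" by (intro sum.cong) auto
  also have "\<dots> = ennreal (\<epsilon> * real n)"
    using assms by (simp add: sum_ennreal mult.commute ennreal_of_nat_eq_real_of_nat flip: ennreal_mult'')
  finally have s: "(\<Sum>k<n. ?s k) = ennreal (\<epsilon> * real n)" .
  have "h \<le> ennreal \<epsilon> + ennreal (\<epsilon> * real n)"
    using n assms by (simp add: algebra_simps flip: ennreal_plus)
  also have "\<dots> \<le> ennreal \<epsilon> + suminf ?s"
    unfolding s[symmetric] by (intro add_left_mono sum_le_suminf) auto
  finally show ?thesis .
next
  case False
  then have "?s = (\<lambda>k. ennreal \<epsilon>)" by (auto simp: not_le)
  then have "suminf ?s = (SUP n. of_nat n * ennreal \<epsilon>)"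
    by (simp add: suminf_eq_SUP)
  also have "\<dots> = top"
    using assms by (simp add: SUP_mult_right_ennreal[symmetric] ennreal_SUP_of_nat_eq_top ennreal_top_mult)
  finally show ?thesis by simp
qed

lemma (in prob_space) nn_integral_le_tails:
  assumes [measurable]: "u \<in> borel_measurable M"
    and tails: "\<And>\<epsilon> N. 0 < \<epsilon> \<Longrightarrow>
      (\<Sum>k<N. ennreal \<epsilon> * emeasure M {x \<in> space M. ennreal (\<epsilon> * real (Suc k)) < u x}) \<le> c"
  shows "(\<integral>\<^sup>+x. u x \<partial>M) \<le> c"
proof (rule ennreal_le_epsilon)
  fix \<epsilon> :: real assume \<epsilon>: "0 < \<epsilon>"
  let ?A = "\<lambda>k. {x \<in> space M. ennreal (\<epsilon> * real (Suc k)) < u x}"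
  have "(\<integral>\<^sup>+x. u x \<partial>M) \<le> (\<integral>\<^sup>+x. ennreal \<epsilon> + (\<Sum>k. ennreal \<epsilon> * indicator (?A k) x) \<partial>M)"
  proof (rule nn_integral_mono)
    fix x assume "x \<in> space M"
    then have "(\<lambda>k. ennreal \<epsilon> * indicator (?A k) x) = (\<lambda>k. if ennreal (\<epsilon> * real (Suc k)) < u x then ennreal \<epsilon> else 0)"
      by (auto simp: indicator_def)
    then show "u x \<le> ennreal \<epsilon> + (\<Sum>k. ennreal \<epsilon> * indicator (?A k) x)"
      using le_staircase_ennreal[OF \<epsilon>, of "u x"] by (simp only:)
  qed
  also have "\<dots> = ennreal \<epsilon> + (\<Sum>k. ennreal \<epsilon> * emeasure M (?A k))"
    by (simp add: nn_integral_add nn_integral_suminf nn_integral_cmult emeasure_space_1)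
  also have "\<dots> \<le> ennreal \<epsilon> + c"
    by (intro add_left_mono suminf_le_const tails[OF \<epsilon>]) auto
  finally show "(\<integral>\<^sup>+x. u x \<partial>M) \<le> c + ennreal \<epsilon>" by (simp add: add.commute)
qed

lemma tails_le_nn_integral:
  assumes [measurable]: "v \<in> borel_measurable M" and \<epsilon>: "0 < \<epsilon>"
  shows "(\<Sum>k<N. ennreal \<epsilon> * emeasure M {x \<in> space M. ennreal (\<epsilon> * real (Suc k)) < v x}) \<le> (\<integral>\<^sup>+x. v x \<partial>M)"
proof -
  let ?A = "\<lambda>k. {x \<in> space M. ennreal (\<epsilon> * real (Suc k)) < v x}"
  have "(\<Sum>k<N. ennreal \<epsilon> * emeasure M (?A k)) = (\<integral>\<^sup>+x. (\<Sum>k<N. ennreal \<epsilon> * indicator (?A k) x) \<partial>M)"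
    by (subst nn_integral_sum) (auto simp: nn_integral_cmult)
  also have "\<dots> \<le> (\<integral>\<^sup>+x. v x \<partial>M)"
  proof (rule nn_integral_mono)
    fix x assume "x \<in> space M"
    then have "(\<Sum>k<N. ennreal \<epsilon> * indicator (?A k) x) = (\<Sum>k<N. if ennreal (\<epsilon> * real (Suc k)) < v x then ennreal \<epsilon> else 0)"
      by (intro sum.cong) (auto simp: indicator_def)
    then show "(\<Sum>k<N. ennreal \<epsilon> * indicator (?A k) x) \<le> v x"
      using staircase_le_ennreal[OF \<epsilon>, where h="v x"] by (simp only:)
  qed
  finally show ?thesis .
qed

text \<open>
  The tails of \<open>u\<close> are the complements of its sublevel sets, so each staircase sum of
  \<open>u\<close> is at most that of \<open>v\<close>.
\<close>

lemma (in prob_space) nn_integral_mono_tails: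
  assumes [measurable]: "u \<in> borel_measurable M" "v \<in> borel_measurable M"
    and le: "\<And>t. emeasure M {x \<in> space M. v x \<le> t} \<le> emeasure M {x \<in> space M. u x \<le> t}"
  shows "(\<integral>\<^sup>+x. u x \<partial>M) \<le> (\<integral>\<^sup>+x. v x \<partial>M)"
proof (rule nn_integral_le_tails)
  have compl: "emeasure M {x \<in> space M. t < w x} = 1 - emeasure M {x \<in> space M. w x \<le> t}"
    if [measurable]: "w \<in> borel_measurable M" for t and w :: "'a \<Rightarrow> ennreal"
  proof -
    have "{x \<in> space M. t < w x} = space M - {x \<in> space M. w x \<le> t}" by auto
    then show ?thesis by (simp add: emeasure_compl emeasure_space_1)
  qed
  fix \<epsilon> :: real and N assume \<epsilon>: "0 < \<epsilon>"
  have "(\<Sum>k<N. ennreal \<epsilon> * emeasure M {x \<in> space M. ennreal (\<epsilon> * real (Suc k)) < u x})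
      \<le> (\<Sum>k<N. ennreal \<epsilon> * emeasure M {x \<in> space M. ennreal (\<epsilon> * real (Suc k)) < v x})"
    using le by (intro sum_mono mult_left_mono) (auto simp: compl intro!: ennreal_mono_minus)
  also have "\<dots> \<le> (\<integral>\<^sup>+x. v x \<partial>M)" by (rule tails_le_nn_integral[OF _ \<epsilon>]) simp
  finally show "(\<Sum>k<N. ennreal \<epsilon> * emeasure M {x \<in> space M. ennreal (\<epsilon> * real (Suc k)) < u x}) \<le> (\<integral>\<^sup>+x. v x \<partial>M)" .
qed simp

section \<open>Integrals against invariant measures are bounded by orbit averages\<close>

text \<open>
  Lower semi-continuity of a cost, through closed sublevel sets: these are the sets whose preimages
  under a closed relation are closed again, hence measurable.
\<close>

definition lsc_cost :: "'a topology \<Rightarrow> ('a \<Rightarrow> ennreal) \<Rightarrow> bool" where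
  "lsc_cost X w \<longleftrightarrow> (\<forall>c. closedin X {x \<in> topspace X. w x \<le> c})"

lemma lsc_cost_measurable:
  assumes M: "borel_prob X M" and "lsc_cost X w"
  shows "w \<in> borel_measurable M"
proof (rule borel_measurableI_le)
  fix c
  have "space M = topspace X" using M by (simp add: borel_prob_def)
  then show "{x \<in> space M. w x \<le> c} \<in> sets M"
    using borel_prob_closedin[OF M] assms(2) by (simp add: lsc_cost_def)
qed

text \<open>
  The alternatives \<open>p = 0\<close> and \<open>q = 0\<close> are needed because nothing lies
  strictly below a vanishing summand.
\<close>

lemma less_add_ennrealE:
  fixes a b c :: ennreal
  assumes "c < a + b"
  obtains p q where "p = 0 \<or> p < a" "q = 0 \<or> q < b" "c < p + q"
proof (cases "a = top \<or> b = top")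
  case True
  have c: "c < c + 1" "c + 1 < top"
    using assms by (auto simp: ennreal_add_eq_top less_top top_unique[symmetric] ennreal_add_left_cancel_less dest: less_le_trans[OF _ top_greatest])
  show ?thesis using True c that[of "c + 1" 0] that[of 0 "c + 1"] by auto
next
  case False
  then obtain a' b' where ab: "a = ennreal a'" "0 \<le> a'" "b = ennreal b'" "0 \<le> b'"
    by (metis ennreal_cases)
  obtain c' where c: "c = ennreal c'" "0 \<le> c'"
    using assms ab by (cases c) auto
  have lt: "c' < a' + b'" using assms ab c by (simp add: ennreal_less_iff flip: ennreal_plus)
  define e where "e = (a' + b' - c') / 3"
  have e: "e > 0" "c' < (a' - e) + (b' - e)" using lt by (auto simp: e_def field_simps)
  show ?thesis
  proof (rule that[of "ennreal (max 0 (a' - e))" "ennreal (max 0 (b' - e))"])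
    show "ennreal (max 0 (a' - e)) = 0 \<or> ennreal (max 0 (a' - e)) < a"
      using ab e by (auto simp: ennreal_less_iff max_def)
    show "ennreal (max 0 (b' - e)) = 0 \<or> ennreal (max 0 (b' - e)) < b"
      using ab e by (auto simp: ennreal_less_iff max_def)
    have "c' < max 0 (a' - e) + max 0 (b' - e)" using e by linarith
    then have "ennreal c' < ennreal (max 0 (a' - e) + max 0 (b' - e))"
      using c(2) by (subst ennreal_less_iff) auto
    also have "\<dots> = ennreal (max 0 (a' - e)) + ennreal (max 0 (b' - e))"
      by (rule ennreal_plus) auto
    finally show "c < ennreal (max 0 (a' - e)) + ennreal (max 0 (b' - e))"
      by (simp only: c(1))
  qed
qed

lemma lsc_cost_add:
  assumes "lsc_cost X v" "lsc_cost X w"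
  shows "lsc_cost X (\<lambda>x. v x + w x)"
  unfolding lsc_cost_def
proof
  fix c
  have op: "openin X {x \<in> topspace X. p = 0 \<or> p < u x}" if "lsc_cost X u" for u p
  proof (cases "p = 0")
    case False
    have "{x \<in> topspace X. p < u x} = topspace X - {x \<in> topspace X. u x \<le> p}" by auto
    then show ?thesis using that False by (simp add: lsc_cost_def openin_diff)
  qed simp
  have "{x \<in> topspace X. c < v x + w x}
      = (\<Union>(p,q)\<in>{(p,q). c < p + q}. {x \<in> topspace X. p = 0 \<or> p < v x} \<inter> {x \<in> topspace X. q = 0 \<or> q < w x})"
    (is "?L = ?R")
  proof
    show "?L \<subseteq> ?R"
    proof
      fix x assume x: "x \<in> ?L"
      then obtain p q where "p = 0 \<or> p < v x" "q = 0 \<or> q < w x" "c < p + q"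
        using less_add_ennrealE[of c "v x" "w x"] by blast
      with x show "x \<in> ?R" by blast
    qed
    show "?R \<subseteq> ?L"
    proof clarsimp
      fix x p q assume "p = 0 \<or> p < v x" "q = 0 \<or> q < w x" and c: "c < p + q"
      then have "p \<le> v x" "q \<le> w x" by auto
      then show "c < v x + w x" using c add_mono less_le_trans by blast
    qed
  qed
  also have "openin X \<dots>"
    using op[OF assms(1)] op[OF assms(2)] by (intro openin_Union) auto
  finally have "openin X {x \<in> topspace X. c < v x + w x}" .
  moreover have "{x \<in> topspace X. v x + w x \<le> c} = topspace X - {x \<in> topspace X. c < v x + w x}" by auto
  ultimately show "closedin X {x \<in> topspace X. v x + w x \<le> c}" by (simp add: closedin_diff)
qed

context compact_relation
begin

text \<open>
  The infimum over \<open>T x\<close> is at most \<open>c\<close> iff \<open>T x\<close> meets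
  \<open>{w \<le> c'}\<close> for every \<open>c' > c\<close>; this formulation covers an empty
  \<open>T x\<close> and an infimum that is not attained.
\<close>

lemma lsc_cost_INF:
  assumes "lsc_cost X w" shows "lsc_cost X (\<lambda>x. INF y\<in>T x. w y)"
  unfolding lsc_cost_def
proof
  fix c :: ennreal
  show "closedin X {x \<in> topspace X. (INF y\<in>T x. w y) \<le> c}"
  proof (cases "c = top")
    case False
    have "{x \<in> topspace X. (INF y\<in>T x. w y) \<le> c} = (\<Inter>c'\<in>{c<..}. inv_image_map X T {x \<in> topspace X. w x \<le> c'})"
      (is "?L = ?R")
    proof
      show "?L \<subseteq> ?R"
      proof clarify
        fix x c' assume x: "x \<in> topspace X" "(INF y\<in>T x. w y) \<le> c" "c < c'"
        then have "(INF y\<in>T x. w y) < c'" by (rule_tac le_less_trans)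
        then obtain y where "y \<in> T x" "w y < c'" by (auto simp: INF_less_iff)
        then have "y \<in> T x \<inter> {x \<in> topspace X. w x \<le> c'}"
          using value_subset[OF x(1)] by auto
        then show "x \<in> inv_image_map X T {x \<in> topspace X. w x \<le> c'}"
          using x(1) by (auto simp: inv_image_map_def)
      qed
      show "?R \<subseteq> ?L"
      proof
        fix x assume x: "x \<in> ?R"
        have "top \<in> {c<..}" using False by (simp add: less_top)
        then have "x \<in> topspace X" using x by (auto simp: inv_image_map_def)
        moreover have "(INF y\<in>T x. w y) \<le> c"
        proof (rule dense_ge)
          fix c' assume "c < c'"
          then obtain y where "y \<in> T x" "w y \<le> c'" using x by (auto simp: inv_image_map_def)
          then show "(INF y\<in>T x. w y) \<le> c'" by (rule INF_lower2)
        qed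
        ultimately show "x \<in> ?L" by simp
      qed
    qed
    moreover have "{c<..} \<noteq> {}" using False by (auto simp: less_top)
    ultimately show ?thesis
      using assms by (auto simp: lsc_cost_def intro!: closedin_INT closedin_inv_image)
  qed simp
qed

text \<open>
  The only use of invariance in the estimate of integrals: the preimage of the sublevel set
  \<open>{w \<le> t}\<close> is contained in the sublevel set of the infimum, so the infimum is
  stochastically dominated by \<open>w\<close>.
\<close>

lemma nn_integral_INF_le:
  assumes M: "M \<in> invariant_measures X T" and w: "lsc_cost X w"
  shows "(\<integral>\<^sup>+x. (INF y\<in>T x. w y) \<partial>M) \<le> (\<integral>\<^sup>+x. w x \<partial>M)"
proof -
  have bp: "borel_prob X M" using M by (simp add: invariant_measures_def)
  interpret prob_space M using bp by (simp add: borel_prob_def)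
  have sp: "space M = topspace X" using bp by (simp add: borel_prob_def)
  note meas = lsc_cost_measurable[OF bp w] lsc_cost_measurable[OF bp lsc_cost_INF[OF w]]
  show ?thesis
  proof (rule nn_integral_mono_tails[OF meas(2,1)])
    fix t
    let ?K = "{x \<in> topspace X. w x \<le> t}"
    have "emeasure M ?K \<le> emeasure M (inv_image_map X T ?K)"
      using w by (intro invariant_on_closed[OF M]) (simp add: lsc_cost_def)
    also have "\<dots> \<le> emeasure M {x \<in> space M. (INF y\<in>T x. w y) \<le> t}"
    proof (rule emeasure_mono)
      show "inv_image_map X T ?K \<subseteq> {x \<in> space M. (INF y\<in>T x. w y) \<le> t}"
        by (auto simp: inv_image_map_def sp intro: INF_lower2)
    qed (use meas(2) in measurable)
    finally show "emeasure M {x \<in> space M. w x \<le> t} \<le> emeasure M {x \<in> space M. (INF y\<in>T x. w y) \<le> t}"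
      by (simp add: sp)
  qed
qed

text \<open>
  Least total cost of an orbit with \<open>n + 1\<close> points from a given start, by the Bellman
  recursion. As the infimum of the empty set is \<open>top\<close>, points without such an orbit
  have infinite cost.
\<close>

primrec least_cost :: "('a \<Rightarrow> ennreal) \<Rightarrow> nat \<Rightarrow> 'a \<Rightarrow> ennreal" where
  "least_cost h 0 = h"
| "least_cost h (Suc n) = (\<lambda>x. h x + (INF y\<in>T x. least_cost h n y))"

lemma lsc_least_cost: "lsc_cost X h \<Longrightarrow> lsc_cost X (least_cost h n)"
  by (induction n) (auto intro: lsc_cost_add lsc_cost_INF)

lemma nn_integral_least_cost_le:
  assumes M: "M \<in> invariant_measures X T" and h: "lsc_cost X h"
  shows "(\<integral>\<^sup>+x. least_cost h n x \<partial>M) \<le> of_nat (Suc n) * (\<integral>\<^sup>+x. h x \<partial>M)"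
proof (induction n)
  case (Suc n)
  have bp: "borel_prob X M" using M by (simp add: invariant_measures_def)
  have "(\<integral>\<^sup>+x. least_cost h (Suc n) x \<partial>M) = (\<integral>\<^sup>+x. h x \<partial>M) + (\<integral>\<^sup>+x. (INF y\<in>T x. least_cost h n y) \<partial>M)"
    by (simp add: nn_integral_add lsc_cost_measurable[OF bp] h lsc_cost_INF lsc_least_cost)
  also have "\<dots> \<le> (\<integral>\<^sup>+x. h x \<partial>M) + of_nat (Suc n) * (\<integral>\<^sup>+x. h x \<partial>M)"
    using nn_integral_INF_le[OF M lsc_least_cost[OF h]] Suc by (intro add_left_mono) (rule order_trans)
  also have "\<dots> = of_nat (Suc (Suc n)) * (\<integral>\<^sup>+x. h x \<partial>M)"
    by (simp add: algebra_simps)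
  finally show ?case .
qed simp

text \<open>
  The recursion does not undercut the costs of actual orbits: prepending \<open>x\<close> to an
  orbit that starts in \<open>T x\<close> gives an orbit from \<open>x\<close>.
\<close>

lemma le_least_cost:
  assumes "x \<in> topspace X"
    and "\<And>z. z \<in> finite_orbits X T n \<Longrightarrow> z 0 = x \<Longrightarrow> b \<le> (\<Sum>k\<le>n. h (z k))"
  shows "b \<le> least_cost h n x"
  using assms
proof (induction n arbitrary: x b)
  case 0
  have "(\<lambda>k. if k = 0 then x else undefined) \<in> finite_orbits X T 0"
    using 0(1) by (auto simp: finite_orbits_def)
  from 0(2)[OF this] show ?case by simp
next
  case (Suc n)
  show ?case
  proof (cases "h x = top")
    case False
    have "b - h x \<le> (INF y\<in>T x. least_cost h n y)"
    proof (rule INF_greatest)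
      fix y assume y: "y \<in> T x"
      show "b - h x \<le> least_cost h n y"
      proof (rule Suc.IH)
        show "y \<in> topspace X" using y value_subset Suc.prems(1) by blast
        fix z assume z: "z \<in> finite_orbits X T n" "z 0 = y"
        have "case_nat x z \<in> finite_orbits X T (Suc n)"
          using z y Suc.prems(1)
          by (fastforce simp: finite_orbits_def PiE_iff extensional_def split: nat.splits)
        from Suc.prems(2)[OF this] have "b \<le> (\<Sum>k\<le>Suc n. h (case_nat x z k))" by simp
        then have "b \<le> h x + (\<Sum>k\<le>n. h (z k))" by (simp only: sum.atMost_Suc_shift nat.case)
        then show "b - h x \<le> (\<Sum>k\<le>n. h (z k))" using False by (simp add: ennreal_minus_le_iff)
      qed
    qed
    then show ?thesis by (simp add: ennreal_minus_le_iff)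
  qed simp
qed

end

text \<open>
  The cost \<open>C - f\<close> is nonnegative, so its integral is defined in
  \<open>ennreal\<close>, and it is infinite exactly when the integral of \<open>f\<close> is
  \<open>-\<infinity>\<close>.
\<close>

lemma ext_integral_bounded_above:
  assumes M: "borel_prob X M" and f: "f \<in> borel_measurable M"
    and C: "0 \<le> C" "\<And>x. x \<in> topspace X \<Longrightarrow> f x \<le> C"
  shows "ext_integral M f = ereal C - enn2ereal (\<integral>\<^sup>+x. ennreal (C - f x) \<partial>M)"
proof -
  interpret prob_space M using M by (simp add: borel_prob_def)
  have sp: "space M = topspace X" using M by (simp add: borel_prob_def)
  note [measurable] = f
  let ?A = "\<integral>\<^sup>+x. ennreal (f x) \<partial>M" and ?B = "\<integral>\<^sup>+x. ennreal (- f x) \<partial>M"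
    and ?I = "\<integral>\<^sup>+x. ennreal (C - f x) \<partial>M"
  have "ennreal C + ?B = (\<integral>\<^sup>+x. ennreal C + ennreal (- f x) \<partial>M)"
    by (simp add: nn_integral_add emeasure_space_1)
  also have "\<dots> = (\<integral>\<^sup>+x. ennreal (f x) + ennreal (C - f x) \<partial>M)"
  proof (rule nn_integral_cong)
    fix x assume "x \<in> space M"
    then have "f x \<le> C" using C sp by simp
    then show "ennreal C + ennreal (- f x) = ennreal (f x) + ennreal (C - f x)"
      using C(1) by (cases "0 \<le> f x") (auto simp: ennreal_neg simp flip: ennreal_plus)
  qed
  also have "\<dots> = ?A + ?I" by (simp add: nn_integral_add)
  finally have eq: "ennreal C + ?B = ?A + ?I" .
  have "?A \<le> (\<integral>\<^sup>+x. ennreal C \<partial>M)"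
    using C sp by (intro nn_integral_mono ennreal_leI) auto
  then have "?A \<le> ennreal C" by (simp add: emeasure_space_1)
  then have "?A \<noteq> top" by (auto simp: top_unique)
  then obtain a where a: "?A = ennreal a" "0 \<le> a" by (metis ennreal_cases)
  show ?thesis
  proof (cases "?B = top")
    case True
    then have "ennreal a + ?I = top" using eq a by (metis ennreal_add_eq_top)
    then have "?I = top" unfolding ennreal_add_eq_top by simp
    then show ?thesis using True a by (simp add: ext_integral_def)
  next
    case False
    then obtain b where b: "?B = ennreal b" "0 \<le> b" by (metis ennreal_cases)
    have "?I \<noteq> top" using eq a b C by (auto simp flip: ennreal_plus)
    then obtain i where i: "?I = ennreal i" "0 \<le> i" by (metis ennreal_cases)
    have "C + b = a + i" using eq a b i C by (simp flip: ennreal_plus)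
    then show ?thesis using a b i by (simp add: ext_integral_def)
  qed
qed

lemma usc_fun_measurable:
  assumes M: "borel_prob X M" and f: "usc_fun X f"
  shows "f \<in> borel_measurable M"
  unfolding borel_measurable_iff_less
proof
  fix c
  have "{x \<in> topspace X. f x < c} \<in> sigma_sets (topspace X) {U. openin X U}"
    using f by (intro sigma_sets.Basic) (simp add: usc_fun_def)
  then show "{x \<in> space M. f x < c} \<in> sets M"
    using M by (simp add: borel_prob_def)
qed

lemma usc_fun_closedin:
  assumes "usc_fun X f" shows "closedin X {x \<in> topspace X. c \<le> f x}"
proof -
  have "{x \<in> topspace X. c \<le> f x} = topspace X - {x \<in> topspace X. f x < c}" by auto
  then show ?thesis using assms by (simp add: usc_fun_def closedin_diff)
qed

lemma lsc_cost_usc_fun: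
  assumes "usc_fun X f" shows "lsc_cost X (\<lambda>x. ennreal (C - f x))"
  unfolding lsc_cost_def
proof
  fix c :: ennreal
  show "closedin X {x \<in> topspace X. ennreal (C - f x) \<le> c}"
  proof (cases c)
    case (real r)
    then have "{x \<in> topspace X. ennreal (C - f x) \<le> c} = {x \<in> topspace X. C - r \<le> f x}"
      by (auto simp: ennreal_le_iff2)
    then show ?thesis using usc_fun_closedin[OF assms] by simp
  qed simp
qed

lemma usc_fun_bounded_above:
  assumes "compact_space X" "usc_fun X f"
  obtains C where "0 < C" "\<And>x. x \<in> topspace X \<Longrightarrow> f x \<le> C"
proof -
  let ?U = "\<lambda>n::nat. {x \<in> topspace X. f x < real n}"
  have "topspace X \<subseteq> \<Union> (range ?U)" using reals_Archimedean2 by auto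
  then obtain F where F: "finite F" "F \<subseteq> range ?U" "topspace X \<subseteq> \<Union>F"
    using compactinD[of X "topspace X" "range ?U"] assms unfolding compact_space_def usc_fun_def by auto
  then obtain J where J: "finite J" "F = ?U ` J" using finite_subset_image[OF F(1,2)] by blast
  have "f x \<le> real (Max (insert 1 J))" if x: "x \<in> topspace X" for x
  proof -
    obtain j where j: "j \<in> J" "f x < real j" using F(3) J(2) x by auto
    then have "j \<le> Max (insert 1 J)" using J by (intro Max_ge) auto
    then show ?thesis using j by linarith
  qed
  moreover have "1 \<le> Max (insert 1 J)" using J by (intro Max_ge) auto
  ultimately show ?thesis using that[of "real (Max (insert 1 J))"] by simp
qed

context compact_relation
begin

lemma ext_integral_le_orbit_average:
  assumes M: "M \<in> invariant_measures X T" and f: "usc_fun X f"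
    and z: "\<And>x. x \<in> finite_orbits X T n \<Longrightarrow> birkhoff_sum f n x \<le> (real n + 1) * z"
  shows "ext_integral M f \<le> ereal z"
proof -
  have bp: "borel_prob X M" using M by (simp add: invariant_measures_def)
  interpret prob_space M using bp by (simp add: borel_prob_def)
  have sp: "space M = topspace X" using bp by (simp add: borel_prob_def)
  obtain C where C: "0 < C" "\<And>x. x \<in> topspace X \<Longrightarrow> f x \<le> C"
    using usc_fun_bounded_above[OF compact f] by blast
  let ?h = "\<lambda>x. ennreal (C - f x)"
  let ?I = "\<integral>\<^sup>+x. ?h x \<partial>M"
  let ?b = "ennreal ((real n + 1) * (C - z))"
  have "?b \<le> least_cost ?h n x" if "x \<in> topspace X" for x
  proof (rule le_least_cost[OF that])
    fix y assume y: "y \<in> finite_orbits X T n"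
    then have yX: "y k \<in> topspace X" if "k \<le> n" for k
      using that by (auto simp: finite_orbits_def)
    have "(real n + 1) * (C - z) \<le> (real n + 1) * C - birkhoff_sum f n y"
      using z[OF y] by (simp add: algebra_simps)
    also have "\<dots> = (\<Sum>k\<le>n. C - f (y k))"
      by (simp add: birkhoff_sum_def sum_subtractf)
    finally show "?b \<le> (\<Sum>k\<le>n. ?h (y k))"
      using C(2) yX by (subst sum_ennreal) (auto intro!: ennreal_leI)
  qed
  then have "(\<integral>\<^sup>+x. ?b \<partial>M) \<le> (\<integral>\<^sup>+x. least_cost ?h n x \<partial>M)"
    using sp by (intro nn_integral_mono) auto
  then have "?b \<le> (\<integral>\<^sup>+x. least_cost ?h n x \<partial>M)" by (simp add: emeasure_space_1)
  also have "\<dots> \<le> of_nat (Suc n) * ?I"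
    by (rule nn_integral_least_cost_le[OF M lsc_cost_usc_fun[OF f]])
  finally have le: "?b \<le> of_nat (Suc n) * ?I" .
  have eq: "ext_integral M f = ereal C - enn2ereal ?I"
    using C by (intro ext_integral_bounded_above[OF bp usc_fun_measurable[OF bp f]]) auto
  show ?thesis
  proof (cases ?I)
    case (real i)
    have "of_nat (Suc n) * ?I = ennreal ((real n + 1) * i)"
      unfolding real ennreal_of_nat_eq_real_of_nat
      by (subst ennreal_mult[symmetric]) (use real in auto)
    then have "?b \<le> ennreal ((real n + 1) * i)" using le by simp
    then have "(real n + 1) * (C - z) \<le> (real n + 1) * i"
      using real by (simp add: ennreal_le_iff)
    then have "C - z \<le> i" by simp
    then show ?thesis using eq real by simp
  qed (simp add: eq)
qed

lemma alpha_le_delta: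
  assumes f: "usc_fun X f"
  shows "erg_alpha X T f \<le> erg_delta X T f"
  unfolding erg_alpha_def
proof (rule SUP_least)
  fix M assume M: "M \<in> invariant_measures X T"
  have "ext_integral M f \<le> (SUP x\<in>finite_orbits X T n. ereal (birkhoff_sum f n x)) / ereal (real n + 1)"
    (is "_ \<le> ?s / _") for n
  proof (rule ereal_le_real)
    fix z assume "?s / ereal (real n + 1) \<le> ereal z"
    then have "?s \<le> ereal (real n + 1) * ereal z"
      by (intro ereal_divide_le_pos[THEN iffD1]) auto
    then show "ext_integral M f \<le> ereal z"
      by (intro ext_integral_le_orbit_average[OF M f, of n]) (auto simp: SUP_le_iff)
  qed
  then show "ext_integral M f \<le> erg_delta X T f"
    unfolding erg_delta_def by (intro le_Limsup) auto
qed

end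

section \<open>Regular measures from finitely additive contents\<close>

text \<open>
  A finitely additive probability \<open>\<phi>\<close> on the subsets of a compact normal space
  gives rise to a Borel probability measure by inner approximation of open sets by closed sets,
  followed by outer approximation of arbitrary sets by open sets, as in the construction of Haar
  measure or in the Riesz representation theorem. Countable subadditivity comes from compactness,
  although \<open>\<phi>\<close> itself may be far from countably additive.
\<close>

locale content_on =
  fixes X :: "'a topology" and \<phi> :: "'a set \<Rightarrow> real"
  assumes compact: "compact_space X" and normal: "normal_space X"
    and nonneg: "\<And>A. A \<subseteq> topspace X \<Longrightarrow> 0 \<le> \<phi> A"
    and additive: "\<And>A B. A \<subseteq> topspace X \<Longrightarrow> B \<subseteq> topspace X \<Longrightarrow> A \<inter> B = {} \<Longrightarrow> \<phi> (A \<union> B) = \<phi> A + \<phi> B"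
    and total: "\<phi> (topspace X) = 1"
begin

lemma content_empty [simp]: "\<phi> {} = 0"
  using additive[of "{}" "{}"] by simp

lemma content_mono: "A \<subseteq> B \<Longrightarrow> B \<subseteq> topspace X \<Longrightarrow> \<phi> A \<le> \<phi> B"
  using additive[of A "B - A"] nonneg[of "B - A"] by (simp add: Un_absorb1 subset_iff)

lemma content_subadditive: 
  assumes "A \<subseteq> topspace X" "B \<subseteq> topspace X"
  shows "\<phi> (A \<union> B) \<le> \<phi> A + \<phi> B"
proof -
  have "\<phi> (A \<union> B) = \<phi> A + \<phi> (B - A)"
    using assms additive[of A "B - A"] by (simp add: subset_iff)
  moreover have "\<phi> (B - A) \<le> \<phi> B" using assms by (intro content_mono) auto
  ultimately show ?thesis by simp
qed

definition inner_content :: "'a set \<Rightarrow> ennreal" where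
  "inner_content U = (SUP K\<in>{K. closedin X K \<and> K \<subseteq> U}. ennreal (\<phi> K))"

definition outer_content :: "'a set \<Rightarrow> ennreal" where
  "outer_content A = (INF U\<in>{U. openin X U \<and> A \<subseteq> U}. inner_content U)"

lemma inner_content_upper: "closedin X K \<Longrightarrow> K \<subseteq> U \<Longrightarrow> ennreal (\<phi> K) \<le> inner_content U"
  unfolding inner_content_def by (rule SUP_upper) simp

lemma inner_content_mono: "U \<subseteq> V \<Longrightarrow> inner_content U \<le> inner_content V"
  unfolding inner_content_def by (rule SUP_subset_mono) auto

lemma inner_content_le: 
  assumes "U \<subseteq> topspace X" shows "inner_content U \<le> ennreal (\<phi> U)"
  unfolding inner_content_def by (rule SUP_least) (use assms content_mono in \<open>auto intro!: ennreal_leI\<close>)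

lemma inner_content_empty [simp]: "inner_content {} = 0"
  using inner_content_le[of "{}"] by simp

lemma outer_content_mono: "A \<subseteq> B \<Longrightarrow> outer_content A \<le> outer_content B"
  unfolding outer_content_def by (rule INF_superset_mono) auto

lemma outer_content_openin: "openin X U \<Longrightarrow> outer_content U = inner_content U"
  unfolding outer_content_def by (rule antisym) (auto intro!: INF_lower INF_greatest inner_content_mono)

lemma outer_content_lower: "openin X U \<Longrightarrow> A \<subseteq> U \<Longrightarrow> outer_content A \<le> inner_content U"
  unfolding outer_content_def by (rule INF_lower) simp

text \<open>
  By normality, a closed set covered by two open sets is the union of two closed sets each contained
  in one of them.
\<close>

lemma closed_le_sum_inner_content:
  fixes U :: "nat \<Rightarrow> 'a set"
  assumes "\<And>i. openin X (U i)" "closedin X K" "K \<subseteq> (\<Union>i<n. U i)"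
  shows "ennreal (\<phi> K) \<le> (\<Sum>i<n. inner_content (U i))"
  using assms(2,3)
proof (induction n arbitrary: K)
  case 0
  then show ?case by simp
next
  case (Suc n)
  let ?V = "\<Union>i<n. U i"
  have "closedin X (K - U n)" "openin X ?V" "K - U n \<subseteq> ?V"
    using Suc.prems assms(1) by (auto simp: closedin_diff lessThan_Suc)
  then obtain W where W: "openin X W" "K - U n \<subseteq> W" "X closure_of W \<subseteq> ?V"
    using normal unfolding normal_space_alt by meson
  let ?K1 = "K \<inter> X closure_of W" and ?K2 = "K - W"
  have K: "closedin X ?K1" "closedin X ?K2"
    using Suc.prems W by (auto simp: closedin_diff)
  have "W \<subseteq> X closure_of W" using W(1) by (simp add: closure_of_subset openin_subset)
  then have "K = ?K1 \<union> ?K2" by blast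
  then have "\<phi> K \<le> \<phi> ?K1 + \<phi> ?K2"
    using content_subadditive[of ?K1 ?K2] K closedin_subset by metis
  then have "ennreal (\<phi> K) \<le> ennreal (\<phi> ?K1) + ennreal (\<phi> ?K2)"
    using K nonneg closedin_subset by (metis ennreal_leI ennreal_plus)
  also have "\<dots> \<le> (\<Sum>i<n. inner_content (U i)) + inner_content (U n)"
    using Suc.IH[of ?K1] K W by (intro add_mono inner_content_upper) auto
  finally show ?case by simp
qed

lemma inner_content_UN_le:
  fixes U :: "nat \<Rightarrow> 'a set"
  assumes "\<And>i. openin X (U i)"
  shows "inner_content (\<Union>i. U i) \<le> (\<Sum>i. inner_content (U i))"
  unfolding inner_content_def[of "\<Union>i. U i"]
proof (rule SUP_least, clarify)
  fix K assume K: "closedin X K" "K \<subseteq> (\<Union>i. U i)"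
  have "compactin X K" using K(1) compact closedin_compact_space by blast
  then obtain F where "finite F" "F \<subseteq> range U" "K \<subseteq> \<Union>F"
    using compactinD[of X K "range U"] K(2) assms by (auto simp: image_iff)
  then obtain J where J: "finite J" "K \<subseteq> (\<Union>i\<in>J. U i)"
    by (metis finite_subset_image)
  then obtain n where "J \<subseteq> {..<n}" using finite_nat_iff_bounded by blast
  then have "K \<subseteq> (\<Union>i<n. U i)" using J(2) by blast
  then have "ennreal (\<phi> K) \<le> (\<Sum>i<n. inner_content (U i))"
    using closed_le_sum_inner_content assms K(1) by blast
  also have "\<dots> \<le> (\<Sum>i. inner_content (U i))" by (rule sum_le_suminf) auto
  finally show "ennreal (\<phi> K) \<le> (\<Sum>i. inner_content (U i))" .
qed

lemma outer_content_UN_le: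
  fixes A :: "nat \<Rightarrow> 'a set"
  shows "outer_content (\<Union>n. A n) \<le> (\<Sum>n. outer_content (A n))"
proof (rule ennreal_le_epsilon)
  fix e :: real assume "0 < e" "(\<Sum>n. outer_content (A n)) < top"
  then have *: "outer_content (A n) < outer_content (A n) + e * (1/2)^Suc n" for n
    by (auto simp add: less_top dest!: ennreal_suminf_lessD)
  have "\<exists>U. openin X U \<and> A n \<subseteq> U \<and> inner_content U \<le> outer_content (A n) + e * (1/2)^Suc n" for n
    using *[of n] unfolding outer_content_def[of "A n"] INF_less_iff by (auto simp: less_imp_le)
  then obtain U where U: "\<And>n. openin X (U n)" "\<And>n. A n \<subseteq> U n"
    "\<And>n. inner_content (U n) \<le> outer_content (A n) + e * (1/2)^Suc n" by metis
  have "outer_content (\<Union>n. A n) \<le> inner_content (\<Union>n. U n)"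
    using U by (intro outer_content_lower) blast+
  also have "\<dots> \<le> (\<Sum>n. inner_content (U n))" by (rule inner_content_UN_le[OF U(1)])
  also have "\<dots> \<le> (\<Sum>n. outer_content (A n) + e * (1/2) ^ Suc n)"
    by (intro suminf_le U(3)) auto
  also have "\<dots> = (\<Sum>n. outer_content (A n)) + (\<Sum>n. ennreal e * ennreal ((1/2) ^ Suc n))"
    using \<open>0 < e\<close> by (subst suminf_add[symmetric])
      (auto simp del: ennreal_suminf_cmult simp add: ennreal_mult[symmetric])
  also have "\<dots> = (\<Sum>n. outer_content (A n)) + e"
    unfolding ennreal_suminf_cmult
    by (subst suminf_ennreal_eq[OF zero_le_power power_half_series]) auto
  finally show "outer_content (\<Union>n. A n) \<le> (\<Sum>n. outer_content (A n)) + e" .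
qed

lemma outer_content_empty [simp]: "outer_content {} = 0"
  by (simp add: outer_content_openin)

lemma outer_content_Un_le: "outer_content (A \<union> B) \<le> outer_content A + outer_content B"
proof -
  have "outer_content (\<Union>n. binaryset A B n) \<le> (\<Sum>n. outer_content (binaryset A B n))"
    by (rule outer_content_UN_le)
  also have "(\<Sum>n. outer_content (binaryset A B n)) = outer_content A + outer_content B"
    by (intro sums_unique[symmetric] binaryset_sums) simp
  finally show ?thesis by (simp add: UN_binaryset_eq)
qed

text \<open>
  Caratheodory's condition for open sets: first fill \<open>V \<inter> U\<close> with a closed set
  \<open>K\<close>, then fill the open set \<open>V - K\<close>, which contains
  \<open>V - U\<close>, with a closed set \<open>L\<close>. The two are disjoint, so their
  contents add up to at most the inner content of \<open>V\<close>.
\<close>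

lemma inner_content_add_outer_content_le:
  assumes U: "openin X U" and V: "openin X V"
  shows "inner_content (V \<inter> U) + outer_content (V - U) \<le> inner_content V"
proof -
  have "ennreal (\<phi> K) + outer_content (V - U) \<le> inner_content V" if K: "closedin X K" "K \<subseteq> V \<inter> U" for K
  proof -
    have "ennreal (\<phi> K) + outer_content (V - U) \<le> ennreal (\<phi> K) + inner_content (V - K)"
      using K V by (intro add_left_mono outer_content_lower) auto
    also have "\<dots> = (SUP L\<in>{L. closedin X L \<and> L \<subseteq> V - K}. ennreal (\<phi> K) + ennreal (\<phi> L))"
      unfolding inner_content_def by (rule ennreal_SUP_add_right) (auto intro: exI[of _ "{}"])
    also have "\<dots> \<le> inner_content V"
    proof (rule SUP_least, clarify)
      fix L assume L: "closedin X L" "L \<subseteq> V - K"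
      have "K \<subseteq> topspace X" "L \<subseteq> topspace X" "K \<inter> L = {}"
        using L K closedin_subset by blast+
      then have "ennreal (\<phi> K) + ennreal (\<phi> L) = ennreal (\<phi> (K \<union> L))"
        by (simp add: additive nonneg)
      also have "\<dots> \<le> inner_content V"
        using L K by (intro inner_content_upper) auto
      finally show "ennreal (\<phi> K) + ennreal (\<phi> L) \<le> inner_content V" .
    qed
    finally show ?thesis .
  qed
  moreover have "inner_content (V \<inter> U) + outer_content (V - U)
      = (SUP K\<in>{K. closedin X K \<and> K \<subseteq> V \<inter> U}. ennreal (\<phi> K) + outer_content (V - U))"
    unfolding inner_content_def by (rule ennreal_SUP_add_left[symmetric]) (auto intro: exI[of _ "{}"])
  ultimately show ?thesis by (auto intro: SUP_least)
qed

lemma outer_content_measurable_openin: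
  assumes "openin X U"
  shows "U \<in> lambda_system (topspace X) (Pow (topspace X)) outer_content"
proof -
  have "outer_content (A \<inter> U) + outer_content (A - U) \<le> outer_content A" for A
    unfolding outer_content_def[of A]
  proof (rule INF_greatest, clarify)
    fix V assume V: "openin X V" "A \<subseteq> V"
    have "outer_content (A \<inter> U) + outer_content (A - U) \<le> inner_content (V \<inter> U) + outer_content (V - U)"
      using V assms by (intro add_mono outer_content_lower outer_content_mono) auto
    also have "\<dots> \<le> inner_content V" by (rule inner_content_add_outer_content_le[OF assms V(1)])
    finally show "outer_content (A \<inter> U) + outer_content (A - U) \<le> inner_content V" .
  qed
  moreover have "outer_content A \<le> outer_content (A \<inter> U) + outer_content (A - U)" for A
    using outer_content_Un_le[of "A \<inter> U" "A - U"] by (simp add: Int_Diff_Un)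
  ultimately show ?thesis
    using openin_subset[OF assms]
    by (simp add: algebra.lambda_system_eq[OF algebra_Pow] antisym)
qed

definition content_measure :: "'a measure" where
  "content_measure = measure_of (topspace X) {U. openin X U} outer_content"

lemma openin_Pow: "{U. openin X U} \<subseteq> Pow (topspace X)"
  by (auto dest: openin_subset)

lemma emeasure_content:
  assumes "A \<in> sigma_sets (topspace X) {U. openin X U}"
  shows "emeasure content_measure A = outer_content A"
proof -
  let ?L = "lambda_system (topspace X) (Pow (topspace X)) outer_content"
  let ?S = "sigma_sets (topspace X) {U. openin X U}"
  have "outer_measure_space (Pow (topspace X)) outer_content"
    unfolding outer_measure_space_def positive_def increasing_def countably_subadditive_def
    by (auto intro: outer_content_mono outer_content_UN_le)
  then have L: "measure_space (topspace X) ?L outer_content"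
    by (rule sigma_algebra.caratheodory_lemma[OF sigma_algebra_Pow])
  then have "?S \<subseteq> ?L"
    using outer_content_measurable_openin
    by (intro sigma_algebra.sigma_sets_subset) (auto simp: measure_space_def)
  then have "measure_space (topspace X) ?S outer_content"
    using measure_down[OF L sigma_algebra_sigma_sets[OF openin_Pow]] by blast
  moreover have "sets content_measure = ?S"
    unfolding content_measure_def by (rule sets_measure_of[OF openin_Pow])
  ultimately show ?thesis
    using assms by (intro emeasure_measure_of[OF content_measure_def openin_Pow])
      (auto simp: measure_space_def)
qed

lemma borel_prob_content: "borel_prob X content_measure"
proof -
  have "emeasure content_measure (topspace X) = outer_content (topspace X)"
    by (rule emeasure_content) (auto intro: sigma_sets_top)
  also have "\<dots> = 1"
    unfolding outer_content_openin[OF openin_topspace]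
  proof (rule antisym)
    show "inner_content (topspace X) \<le> 1"
      using inner_content_le[of "topspace X"] by (simp add: total)
    show "1 \<le> inner_content (topspace X)"
      using inner_content_upper[of "topspace X" "topspace X"] by (simp add: total)
  qed
  finally have "emeasure content_measure (topspace X) = 1" .
  moreover have "space content_measure = topspace X"
    "sets content_measure = sigma_sets (topspace X) {U. openin X U}"
    unfolding content_measure_def
    by (rule space_measure_of[OF openin_Pow], rule sets_measure_of[OF openin_Pow])
  ultimately show ?thesis
    unfolding borel_prob_def by (simp add: prob_spaceI)
qed

lemma emeasure_content_openin: "openin X U \<Longrightarrow> emeasure content_measure U = inner_content U"
  by (simp add: emeasure_content outer_content_openin sigma_sets.Basic)

lemma emeasure_content_openin_le: "openin X U \<Longrightarrow> emeasure content_measure U \<le> ennreal (\<phi> U)"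
  by (simp add: emeasure_content_openin inner_content_le openin_subset)

lemma emeasure_content_closedin:
  assumes "closedin X K"
  shows "emeasure content_measure K = (INF U\<in>{U. openin X U \<and> K \<subseteq> U}. inner_content U)"
proof -
  have "topspace X - (topspace X - K) \<in> sigma_sets (topspace X) {U. openin X U}"
    using assms by (intro sigma_sets.Compl sigma_sets.Basic) auto
  then show ?thesis
    using closedin_subset[OF assms] by (simp add: double_diff emeasure_content outer_content_def)
qed

end

section \<open>Orbits all of whose averages are large\<close>

lemma usc_fun_compose:
  assumes "usc_fun X f" "continuous_map Y X p"
  shows "usc_fun Y (\<lambda>y. f (p y))"
  unfolding usc_fun_def
proof
  fix c
  have "p y \<in> topspace X" if "y \<in> topspace Y" for y
    using that continuous_map_funspace[OF assms(2)] by auto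
  then have "{y \<in> topspace Y. f (p y) < c} = {y \<in> topspace Y. p y \<in> {x \<in> topspace X. f x < c}}" by auto
  also have "openin Y \<dots>"
    using assms by (intro openin_continuous_map_preimage) (auto simp: usc_fun_def)
  finally show "openin Y {y \<in> topspace Y. f (p y) < c}" .
qed

lemma usc_fun_add:
  assumes "usc_fun Y f" "usc_fun Y g"
  shows "usc_fun Y (\<lambda>y. f y + g y)"
  unfolding usc_fun_def
proof
  fix c
  have "{y \<in> topspace Y. f y + g y < c} = (\<Union>q. {y \<in> topspace Y. f y < q} \<inter> {y \<in> topspace Y. g y < c - q})"
  proof safe
    fix y assume y: "y \<in> topspace Y" "f y + g y < c"
    then have "f y < (f y + c - g y) / 2" "g y < c - (f y + c - g y) / 2" by (simp_all add: field_simps)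
    with y show "y \<in> (\<Union>q. {y \<in> topspace Y. f y < q} \<inter> {y \<in> topspace Y. g y < c - q})" by blast
  qed auto
  also have "openin Y \<dots>" using assms by (auto simp: usc_fun_def)
  finally show "openin Y {y \<in> topspace Y. f y + g y < c}" .
qed

lemma usc_fun_sum:
  fixes f :: "nat \<Rightarrow> 'a \<Rightarrow> real"
  assumes "\<And>k. usc_fun Y (f k)"
  shows "usc_fun Y (\<lambda>y. \<Sum>k\<le>n. f k y)"
  by (induction n) (use assms in \<open>auto intro: usc_fun_add\<close>)

text \<open>
  The index \<open>k\<close> minimises the partial sums of \<open>g\<close> on
  \<open>{L..n + 1}\<close>, so that all sums starting at \<open>k\<close> are nonnegative. It is
  at least \<open>L\<close> by choice, and not close to \<open>n\<close> because the total is so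
  large that, with increments bounded by \<open>G\<close>, it takes more than \<open>L\<close> steps
  to climb from the minimum to it.
\<close>

lemma nonneg_sums_from_late_index:
  fixes g :: "nat \<Rightarrow> real"
  assumes g: "\<And>i. i \<le> n \<Longrightarrow> g i \<le> G" and G: "0 < G" and L: "L \<le> n"
    and sum: "(2 * real L + 1) * G \<le> (\<Sum>i\<le>n. g i)"
  obtains k where "L \<le> k" "k + L \<le> n" "\<And>m. m \<le> L \<Longrightarrow> 0 \<le> (\<Sum>j\<le>m. g (k + j))"
proof -
  define s where "s k = (\<Sum>i<k. g i)" for k
  have diff: "s (k + m) - s k = (\<Sum>j<m. g (k + j))" for k m
    by (induction m) (auto simp: s_def)
  let ?S = "s ` {L..Suc n}"
  have "Min ?S \<in> ?S" using L by (intro Min_in) auto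
  then obtain k where k: "L \<le> k" "k \<le> Suc n" "s k = Min ?S" by auto
  have min: "s k \<le> s j" if "L \<le> j" "j \<le> Suc n" for j
    unfolding k(3) using that by (intro Min_le) auto
  have "s k \<le> s L" using L by (intro min) auto
  also have "\<dots> \<le> (\<Sum>i<L. G)" unfolding s_def using L by (intro sum_mono g) auto
  finally have 1: "s k \<le> real L * G" by simp
  have "s (Suc n) - s k = (\<Sum>j<Suc n - k. g (k + j))"
    using diff[of k "Suc n - k"] k by simp
  also have "\<dots> \<le> (\<Sum>j<Suc n - k. G)" by (intro sum_mono g) auto
  also have "\<dots> = real (Suc n - k) * G" by simp
  finally have 2: "s (Suc n) - s k \<le> real (Suc n - k) * G" .
  have "(2 * real L + 1) * G \<le> s (Suc n)" using sum by (simp add: s_def lessThan_Suc_atMost)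
  with 1 2 have "(real L + 1) * G \<le> real (Suc n - k) * G" by (simp add: algebra_simps)
  then have "real (Suc L) \<le> real (Suc n - k)" using G by simp
  then have "k + L \<le> n" by linarith
  moreover have "0 \<le> (\<Sum>j\<le>m. g (k + j))" if "m \<le> L" for m
  proof -
    have "s k \<le> s (k + Suc m)" using that k(1) \<open>k + L \<le> n\<close> by (intro min) auto
    then show ?thesis using diff[of k "Suc m"] by (simp add: lessThan_Suc_atMost)
  qed
  ultimately show ?thesis using that k by blast
qed

context compact_relation
begin

abbreviation sequence_space :: "(int \<Rightarrow> 'a) topology" where
  "sequence_space \<equiv> product_topology (\<lambda>_. X) UNIV"

text \<open>
  The orbit segment is taken from the middle of a much longer orbit, which leaves room for
  \<open>L\<close> steps into the past and into the future of the index given by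
  \<open>nonneg_sums_from_late_index\<close>.
\<close>

lemma ex_orbit_segment_large_averages:
  assumes f: "usc_fun X f" and D: "ereal D \<le> erg_delta X T f" and c: "c < D"
  shows "\<exists>x. (\<forall>i. x i \<in> topspace X) \<and> (\<forall>i. - int L \<le> i \<and> i < int L \<longrightarrow> x (i + 1) \<in> T (x i))
    \<and> (\<forall>m\<le>L. (real m + 1) * c \<le> birkhoff_sum f m (\<lambda>k. x (int k)))"
proof -
  obtain C where C: "0 < C" "\<And>x. x \<in> topspace X \<Longrightarrow> f x \<le> C"
    using usc_fun_bounded_above[OF compact f] by blast
  define G where "G = C + \<bar>c\<bar>"
  have G: "0 < G" "\<And>x. x \<in> topspace X \<Longrightarrow> f x - c \<le> G"
    using C by (force simp: G_def)+
  \<comment> \<open>The gap \<open>c' - c\<close> per step makes the total of \<open>f - c\<close> along a long orbit exceed the fixed bound that the choice of a late index requires.\<close>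
  define c' where "c' = (c + D) / 2"
  have c': "c < c'" "c' < D" using c by (auto simp: c'_def)
  obtain N0 where N0: "(2 * real L + 1) * G \<le> real N0 * (c' - c)"
    using reals_Archimedean3[of "c' - c"] c' by (metis diff_gt_0_iff_gt less_imp_le)
  define N where "N = max N0 L"
  let ?a = "\<lambda>n. (SUP x\<in>finite_orbits X T n. ereal (birkhoff_sum f n x)) / ereal (real n + 1)"
  have "\<exists>n\<ge>N. ereal c' < ?a n"
  proof (rule ccontr)
    assume "\<not> ?thesis"
    then have "\<forall>\<^sub>F n in sequentially. ?a n \<le> ereal c'"
      unfolding eventually_sequentially by (meson not_le)
    then have "erg_delta X T f \<le> ereal c'"
      unfolding erg_delta_def by (rule Limsup_bounded)
    with D c' show False by (meson ereal_less_eq(3) not_le order_trans)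
  qed
  then obtain n where n: "N \<le> n" "\<not> ?a n \<le> ereal c'" by (auto simp: not_le)
  have "\<exists>y\<in>finite_orbits X T n. (real n + 1) * c' < birkhoff_sum f n y"
  proof (rule ccontr)
    assume "\<not> ?thesis"
    then have "(SUP x\<in>finite_orbits X T n. ereal (birkhoff_sum f n x)) \<le> ereal (real n + 1) * ereal c'"
      by (intro SUP_least) (auto simp: not_less)
    then have "?a n \<le> ereal c'" by (intro ereal_divide_le_pos[THEN iffD2]) auto
    with n(2) show False by blast
  qed
  then obtain y where y: "y \<in> finite_orbits X T n" "(real n + 1) * c' < birkhoff_sum f n y" by blast
  have yX: "y i \<in> topspace X" if "i \<le> n" for i
    using y(1) that by (auto simp: finite_orbits_def)
  have yT: "y (Suc i) \<in> T (y i)" if "i < n" for i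
    using y(1) that by (auto simp: finite_orbits_def)
  have "(2 * real L + 1) * G \<le> (real n + 1) * (c' - c)"
  proof -
    have "real N0 * (c' - c) \<le> (real n + 1) * (c' - c)"
      using n(1) c' by (intro mult_right_mono) (auto simp: N_def)
    with N0 show ?thesis by linarith
  qed
  also have "\<dots> \<le> (\<Sum>i\<le>n. f (y i) - c)"
    using y(2) by (simp add: birkhoff_sum_def sum_subtractf algebra_simps)
  finally have big: "(2 * real L + 1) * G \<le> (\<Sum>i\<le>n. f (y i) - c)" .
  have "L \<le> n" using n(1) by (simp add: N_def)
  then obtain k where k: "L \<le> k" "k + L \<le> n" "\<And>m. m \<le> L \<Longrightarrow> 0 \<le> (\<Sum>j\<le>m. f (y (k + j)) - c)"
    using nonneg_sums_from_late_index[of n "\<lambda>i. f (y i) - c" G L] big G yX by metis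
  \<comment> \<open>The orbit \<open>y\<close> shifted by \<open>k\<close> and extended constantly beyond its two ends; only entries outside the window from \<open>- L\<close> to \<open>L\<close> come from the extension.\<close>
  define x where "x i = y (nat (max 0 (min (int n) (int k + i))))" for i
  have "x i \<in> topspace X" for i unfolding x_def by (rule yX) auto
  moreover have "x (i + 1) \<in> T (x i)" if i: "- int L \<le> i" "i < int L" for i
  proof -
    have "x i = y (nat (int k + i))" "x (i + 1) = y (Suc (nat (int k + i)))"
      using i k by (auto simp: x_def intro!: arg_cong[of _ _ y])
    moreover have "nat (int k + i) < n" using i k by auto
    ultimately show ?thesis using yT by simp
  qed
  moreover have "(real m + 1) * c \<le> birkhoff_sum f m (\<lambda>k. x (int k))" if m: "m \<le> L" for m
  proof -
    have "x (int j) = y (k + j)" if "j \<le> m" for j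
      using that m k by (auto simp: x_def intro!: arg_cong[of _ _ y])
    then have "birkhoff_sum f m (\<lambda>k. x (int k)) = (\<Sum>j\<le>m. f (y (k + j)))"
      unfolding birkhoff_sum_def by (intro sum.cong) auto
    then show ?thesis using k(3)[OF m] by (simp add: sum_subtractf algebra_simps)
  qed
  ultimately show ?thesis by blast
qed

text \<open>
  The sequences that satisfy the conditions on the window \<open>{- L..L}\<close> with the
  threshold \<open>c L\<close> form decreasing nonempty closed sets, because the graph is closed
  and sums of upper semi-continuous functions have closed superlevel sets.
\<close>

lemma ex_orbit_large_averages:
  assumes f: "usc_fun X f" and D: "ereal D \<le> erg_delta X T f"
  obtains x where "x \<in> orbit_space X T" "\<And>n. (real n + 1) * D \<le> birkhoff_sum f n (\<lambda>k. x (int k))"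
proof -
  define c where "c L = D - 1 / (real L + 1)" for L
  let ?Y = sequence_space
  define E where "E L =
    (\<Inter>i. {x \<in> topspace ?Y. - int L \<le> i \<and> i < int L \<longrightarrow> (x i, x (i + 1)) \<in> graph})
    \<inter> (\<Inter>m. {x \<in> topspace ?Y. m \<le> L \<longrightarrow> (real m + 1) * c L \<le> birkhoff_sum f m (\<lambda>k. x (int k))})" for L
  have coord: "continuous_map ?Y X (\<lambda>x. x i)" for i
    by (rule continuous_map_product_coordinates) simp
  have clo1: "closedin ?Y {x \<in> topspace ?Y. - int L \<le> i \<and> i < int L \<longrightarrow> (x i, x (i + 1)) \<in> graph}" for i L
  proof (cases "- int L \<le> i \<and> i < int L")
    case True
    have "closedin ?Y {x \<in> topspace ?Y. (x i, x (i + 1)) \<in> graph}"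
      by (intro closedin_continuous_map_preimage[OF _ closedin_graph])
        (simp add: continuous_map_pairwise o_def coord)
    with True show ?thesis by simp
  next
    case False
    then show ?thesis by (simp only: simp_thms Collect_mem_eq closedin_topspace)
  qed
  have clo2: "closedin ?Y {x \<in> topspace ?Y. m \<le> L \<longrightarrow> r \<le> birkhoff_sum f m (\<lambda>k. x (int k))}" for r m L
  proof (cases "m \<le> L")
    case True
    have "closedin ?Y {x \<in> topspace ?Y. r \<le> birkhoff_sum f m (\<lambda>k. x (int k))}"
      unfolding birkhoff_sum_def
      by (intro usc_fun_closedin usc_fun_sum usc_fun_compose[OF f coord])
    with True show ?thesis by simp
  next
    case False
    then show ?thesis by (simp only: simp_thms Collect_mem_eq closedin_topspace)
  qed
  have clo: "closedin ?Y (E L)" for L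
    unfolding E_def by (intro closedin_Int closedin_INT clo1 clo2) auto
  have E_iff: "x \<in> E L \<longleftrightarrow> (\<forall>i. x i \<in> topspace X)
      \<and> (\<forall>i. - int L \<le> i \<and> i < int L \<longrightarrow> x (i + 1) \<in> T (x i))
      \<and> (\<forall>m\<le>L. (real m + 1) * c L \<le> birkhoff_sum f m (\<lambda>k. x (int k)))" for x L
    unfolding E_def graph_def by (auto simp: PiE_UNIV_domain)
  have "E L \<noteq> {}" for L
  proof -
    have "c L < D" by (simp add: c_def)
    then have "\<exists>x. x \<in> E L"
      unfolding E_iff by (rule ex_orbit_segment_large_averages[OF f D])
    then show ?thesis by blast
  qed
  moreover have "decseq E"
    unfolding decseq_def
  proof (intro allI impI subsetI)
    fix L L' x assume le: "L \<le> L'" and x: "x \<in> E L'"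
    have "c L \<le> c L'" using le by (simp add: c_def frac_le)
    then have "(real m + 1) * c L \<le> (real m + 1) * c L'" for m by (intro mult_left_mono) auto
    then show "x \<in> E L" using x le unfolding E_iff by (smt (verit, best) of_nat_mono le_trans)
  qed
  moreover have "compact_space ?Y"
    using compact by (simp add: compact_space_product_topology)
  ultimately have "(\<Inter>L. E L) \<noteq> {}"
    using clo by (intro compact_space_imp_nest)
  then obtain x where x: "\<And>L. x \<in> E L" by blast
  have "x (i + 1) \<in> T (x i)" for i
  proof -
    have "\<forall>j. - int L \<le> j \<and> j < int L \<longrightarrow> x (j + 1) \<in> T (x j)" for L
      using x[of L] unfolding E_iff by blast
    from this[of "nat (\<bar>i\<bar> + 1)", rule_format, of i] show ?thesis by linarith
  qed
  then have "x \<in> orbit_space X T"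
    using x[of 0] by (simp add: orbit_space_def E_iff)
  moreover have "(real n + 1) * D \<le> birkhoff_sum f n (\<lambda>k. x (int k))" for n
  proof (rule tendsto_upperbound)
    show "(\<lambda>L. (real n + 1) * c L) \<longlonglongrightarrow> (real n + 1) * D"
      unfolding c_def by real_asymp
    show "\<forall>\<^sub>F L in sequentially. (real n + 1) * c L \<le> birkhoff_sum f n (\<lambda>k. x (int k))"
      using eventually_ge_at_top[of n] by eventually_elim (use x in \<open>auto simp: E_iff\<close>)
  qed simp
  ultimately show ?thesis using that by blast
qed

end

section \<open>Invariant measures from orbits\<close>

text \<open>
  Tychonoff's theorem provides a cluster point \<open>\<phi>\<close> of the sequence in a power of
  \<open>{0..1}\<close>. Passing to a finer filter \<open>G\<close> turns it into a genuine limit at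
  all, possibly uncountably many, arguments simultaneously.
\<close>

lemma ex_bounded_pointwise_cluster:
  fixes u :: "nat \<Rightarrow> 'b \<Rightarrow> real"
  assumes "\<And>n b. u n b \<in> {0..1}"
  obtains G \<phi> where "G \<noteq> bot" "G \<le> sequentially" "\<And>b. ((\<lambda>n. u n b) \<longlongrightarrow> \<phi> b) G"
proof -
  have "compactin (product_topology (\<lambda>_. euclidean) UNIV) (PiE UNIV (\<lambda>_::'b. {0..1::real}))"
    by (subst compactin_PiE) simp
  then have "compact (PiE UNIV (\<lambda>_::'b. {0..1::real}))"
    by (simp add: euclidean_product_topology)
  moreover have "eventually (\<lambda>v. v \<in> PiE UNIV (\<lambda>_::'b. {0..1})) (filtermap u sequentially)"
    using assms by (simp add: eventually_filtermap PiE_UNIV_domain)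
  moreover have "filtermap u sequentially \<noteq> bot" by (simp add: filtermap_bot_iff)
  ultimately obtain \<phi> where \<phi>: "inf (nhds \<phi>) (filtermap u sequentially) \<noteq> bot"
    unfolding compact_filter by blast
  define G where "G = inf sequentially (filtercomap u (nhds \<phi>))"
  have "G \<noteq> bot"
  proof
    assume "G = bot"
    then have "eventually (\<lambda>_. False) G" by simp
    then obtain P Q where PQ: "eventually P sequentially" "eventually Q (filtercomap u (nhds \<phi>))"
      "\<And>n. P n \<Longrightarrow> Q n \<Longrightarrow> False"
      unfolding G_def eventually_inf by blast
    then obtain R where R: "eventually R (nhds \<phi>)" "\<And>n. R (u n) \<Longrightarrow> Q n"
      unfolding eventually_filtercomap by blast
    have "eventually (\<lambda>v. \<not> R v) (filtermap u sequentially)"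
      using PQ(1) unfolding eventually_filtermap by eventually_elim (use PQ(3) R(2) in blast)
    with R(1) have "eventually (\<lambda>_. False) (inf (nhds \<phi>) (filtermap u sequentially))"
      unfolding eventually_inf by blast
    with \<phi> show False by (simp add: eventually_False)
  qed
  moreover have "(u \<longlongrightarrow> \<phi>) G"
    unfolding G_def by (rule filterlim_mono[OF filterlim_filtercomap]) auto
  ultimately show ?thesis
    using that[of G \<phi>] by (simp add: G_def tendsto_fun_iff)
qed

context compact_relation
begin

text \<open>
  The empirical frequencies of the orbit are finitely additive, and invariant up to the boundary
  term \<open>1 / (n + 1)\<close>, so a cluster point of them is invariant. It bounds the
  measure generated by it from above on open sets and from below on closed sets. So a closed set
  \<open>K\<close> is replaced by an open \<open>V \<supseteq> K\<close> such that the preimage of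
  the closure of \<open>V\<close> stays in a given neighbourhood of the preimage of
  \<open>K\<close>, and the integral of the cost \<open>C - f\<close> is bounded because its
  strict superlevel sets are open.
\<close>

lemma ex_invariant_measure_from_orbit:
  assumes f: "usc_fun X f" and x: "x \<in> orbit_space X T"
    and avg: "\<And>n. (real n + 1) * D \<le> birkhoff_sum f n (\<lambda>k. x (int k))"
  obtains M where "M \<in> invariant_measures X T" "ereal D \<le> ext_integral M f"
proof -
  define u where "u n A = (\<Sum>k\<le>n. indicator A (x (int k)) :: real) / (real n + 1)" for n A
  have xX: "x i \<in> topspace X" and xT: "x (i + 1) \<in> T (x i)" for i
    using x by (auto simp: orbit_space_def)
  have u01: "u n A \<in> {0..1}" for n A
  proof -
    have "(\<Sum>k\<le>n. indicator A (x (int k)) :: real) \<le> (\<Sum>k\<le>n. 1)"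
      by (intro sum_mono) (auto simp: indicator_def)
    moreover have "0 \<le> (\<Sum>k\<le>n. indicator A (x (int k)) :: real)"
      by (intro sum_nonneg) auto
    ultimately show ?thesis by (simp add: u_def divide_le_eq)
  qed
  obtain G \<phi> where G: "G \<noteq> bot" "G \<le> sequentially" and lim: "\<And>A. ((\<lambda>n. u n A) \<longlongrightarrow> \<phi> A) G"
    using ex_bounded_pointwise_cluster[of u] u01 by metis
  have "content_on X \<phi>"
  proof
    show "compact_space X" "normal_space X"
      using compact metrizable metrizable_imp_normal_space by blast+
    show "0 \<le> \<phi> A" for A
      using u01 by (intro tendsto_lowerbound[OF lim _ G(1)]) auto
    show "\<phi> (A \<union> B) = \<phi> A + \<phi> B" if "A \<inter> B = {}" for A B
    proof -
      have "u n (A \<union> B) = u n A + u n B" for n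
        using that by (simp add: u_def indicator_add[symmetric] sum.distrib add_divide_distrib)
      then have "((\<lambda>n. u n (A \<union> B)) \<longlongrightarrow> \<phi> A + \<phi> B) G"
        using tendsto_add[OF lim lim] by simp
      with lim show ?thesis using tendsto_unique[OF G(1)] by blast
    qed
    have "u n (topspace X) = 1" for n
      using xX by (simp add: u_def)
    then show "\<phi> (topspace X) = 1"
      using lim[of "topspace X"] tendsto_const_iff[OF G(1)] by (metis (no_types, lifting) ext)
  qed
  then interpret content: content_on X \<phi> .
  have inv: "\<phi> A \<le> \<phi> (inv_image_map X T A)" for A
  proof -
    have "u n A \<le> u n (inv_image_map X T A) + 1 / (real n + 1)" for n
    proof -
      let ?B = "inv_image_map X T A"
      have "(\<Sum>k\<le>n. indicator A (x (int k)) :: real) = indicator A (x 0) + (\<Sum>k<n. indicator A (x (int (Suc k))))"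
        by (simp only: sum.lessThan_Suc_shift flip: lessThan_Suc_atMost) simp
      also have "\<dots> \<le> 1 + (\<Sum>k<n. indicator ?B (x (int k)))"
      proof (intro add_mono sum_mono)
        fix k
        have "x (int (Suc k)) \<in> T (x (int k))" using xT[of "int k"] by (simp add: add.commute)
        then show "(indicator A (x (int (Suc k))) :: real) \<le> indicator ?B (x (int k))"
          using xX by (auto simp: indicator_def inv_image_map_def)
      qed (simp add: indicator_def)
      also have "\<dots> \<le> 1 + (\<Sum>k\<le>n. indicator ?B (x (int k)))"
        by (intro add_left_mono sum_mono2) auto
      finally show ?thesis by (simp add: u_def divide_right_mono flip: add_divide_distrib)
    qed
    moreover have "((\<lambda>n. u n (inv_image_map X T A) + 1 / (real n + 1)) \<longlongrightarrow> \<phi> (inv_image_map X T A) + 0) G"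
    proof (intro tendsto_add lim)
      have "(\<lambda>n. 1 / (real n + 1)) \<longlonglongrightarrow> 0" by real_asymp
      then show "((\<lambda>n. 1 / (real n + 1)) \<longlongrightarrow> 0) G" using G(2) by (rule tendsto_mono[rotated])
    qed
    ultimately show ?thesis using tendsto_le[OF G(1) _ lim] by simp
  qed
  let ?M = content.content_measure
  note bp = content.borel_prob_content
  interpret M: prob_space ?M using bp by (simp add: borel_prob_def)
  have sp: "space ?M = topspace X" using bp by (simp add: borel_prob_def)
  have "?M \<in> invariant_measures X T"
  proof (rule invariant_if_invariant_on_closed[OF bp])
    fix K assume K: "closedin X K"
    show "emeasure ?M K \<le> emeasure ?M (inv_image_map X T K)"
      unfolding content.emeasure_content_closedin[OF closedin_inv_image[OF K]]
    proof (rule INF_greatest, clarify)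
      fix U assume U: "openin X U" "inv_image_map X T K \<subseteq> U"
      then obtain V where V: "openin X V" "K \<subseteq> V" "inv_image_map X T (X closure_of V) \<subseteq> U"
        using inv_image_neighbourhood[OF K] by blast
      have VX: "V \<subseteq> topspace X" by (rule openin_subset[OF V(1)])
      have "emeasure ?M K \<le> emeasure ?M V"
        using V borel_prob_closedin[OF bp] bp
        by (intro emeasure_mono) (auto simp: borel_prob_def intro: sigma_sets.Basic)
      also have "\<dots> \<le> ennreal (\<phi> V)" by (rule content.emeasure_content_openin_le[OF V(1)])
      also have "\<dots> \<le> ennreal (\<phi> (X closure_of V))"
        by (intro ennreal_leI content.content_mono closure_of_subset VX closure_of_subset_topspace)
      also have "\<dots> \<le> ennreal (\<phi> (inv_image_map X T (X closure_of V)))"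
        by (intro ennreal_leI inv)
      also have "\<dots> \<le> content.inner_content U"
        by (intro content.inner_content_upper closedin_inv_image V(3)) simp
      finally show "emeasure ?M K \<le> content.inner_content U" .
    qed
  qed
  moreover have "ereal D \<le> ext_integral ?M f"
  proof -
    obtain C where C: "0 < C" "\<And>x. x \<in> topspace X \<Longrightarrow> f x \<le> C"
      using usc_fun_bounded_above[OF compact f] by blast
    note [measurable] = usc_fun_measurable[OF bp f]
    let ?h = "\<lambda>y. C - f y"
    have "D \<le> C" using avg[of 0] C(2)[OF xX[of 0]] by (simp add: birkhoff_sum_def)
    have "(\<integral>\<^sup>+y. ennreal (?h y) \<partial>?M) \<le> ennreal (C - D)"
    proof (rule M.nn_integral_le_tails)
      fix \<epsilon> :: real and N assume \<epsilon>: "0 < \<epsilon>"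
      let ?U = "\<lambda>k::nat. {y \<in> topspace X. \<epsilon> * real (Suc k) < ?h y}"
      have op: "openin X (?U k)" for k
      proof -
        have "?U k = {y \<in> topspace X. f y < C - \<epsilon> * real (Suc k)}" by auto
        then show ?thesis using f by (simp add: usc_fun_def)
      qed
      have "(\<Sum>k<N. \<epsilon> * u n (?U k)) \<le> C - D" for n
      proof -
        have "(\<Sum>k<N. \<epsilon> * u n (?U k)) = (\<Sum>j\<le>n. \<Sum>k<N. \<epsilon> * indicator (?U k) (x (int j))) / (real n + 1)"
          unfolding u_def times_divide_eq_right sum_distrib_left sum_divide_distrib by (rule sum.swap)
        also have "\<dots> \<le> (\<Sum>j\<le>n. ?h (x (int j))) / (real n + 1)"
        proof (intro divide_right_mono sum_mono)
          fix j
          have "(\<Sum>k<N. \<epsilon> * indicator (?U k) (x (int j)))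
              = (\<Sum>k<N. if \<epsilon> * real (Suc k) < ?h (x (int j)) then \<epsilon> else 0)"
            using xX by (intro sum.cong) (auto simp: indicator_def)
          also have "\<dots> \<le> ?h (x (int j))"
            using \<epsilon> C(2) xX by (intro staircase_le) auto
          finally show "(\<Sum>k<N. \<epsilon> * indicator (?U k) (x (int j))) \<le> ?h (x (int j))" .
        qed simp
        also have "\<dots> \<le> C - D"
        proof -
          have "(\<Sum>j\<le>n. ?h (x (int j))) \<le> (C - D) * (real n + 1)"
            using avg[of n] by (simp add: sum_subtractf birkhoff_sum_def algebra_simps)
          then show ?thesis by (simp add: pos_divide_le_eq)
        qed
        finally show ?thesis .
      qed
      moreover have "((\<lambda>n. \<Sum>k<N. \<epsilon> * u n (?U k)) \<longlongrightarrow> (\<Sum>k<N. \<epsilon> * \<phi> (?U k))) G"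
        by (intro tendsto_intros lim)
      ultimately have le: "(\<Sum>k<N. \<epsilon> * \<phi> (?U k)) \<le> C - D"
        using tendsto_upperbound[OF _ _ G(1)] by (metis (no_types, lifting) always_eventually)
      have "(\<Sum>k<N. ennreal \<epsilon> * emeasure ?M {y \<in> space ?M. ennreal (\<epsilon> * real (Suc k)) < ennreal (?h y)})
          = (\<Sum>k<N. ennreal \<epsilon> * emeasure ?M (?U k))"
        using \<epsilon> by (intro sum.cong arg_cong2[of _ _ _ _ "(*)"] arg_cong[of _ _ "emeasure ?M"]) (auto simp: sp ennreal_less_iff)
      also have "\<dots> \<le> (\<Sum>k<N. ennreal \<epsilon> * ennreal (\<phi> (?U k)))"
        by (intro sum_mono mult_left_mono content.emeasure_content_openin_le[OF op]) auto
      also have "\<dots> = (\<Sum>k<N. ennreal (\<epsilon> * \<phi> (?U k)))"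
        using \<epsilon> by (intro sum.cong refl ennreal_mult'[symmetric]) auto
      also have "\<dots> = ennreal (\<Sum>k<N. \<epsilon> * \<phi> (?U k))"
        using \<epsilon> by (intro sum_ennreal mult_nonneg_nonneg content.nonneg) auto
      also have "\<dots> \<le> ennreal (C - D)" by (rule ennreal_leI[OF le])
      finally show "(\<Sum>k<N. ennreal \<epsilon> * emeasure ?M {y \<in> space ?M. ennreal (\<epsilon> * real (Suc k)) < ennreal (?h y)})
        \<le> ennreal (C - D)" .
    qed simp
    then have "enn2ereal (\<integral>\<^sup>+y. ennreal (?h y) \<partial>?M) \<le> ereal (C - D)"
      using \<open>D \<le> C\<close> by (metis diff_ge_0_iff_ge enn2ereal_ennreal less_eq_ennreal.rep_eq)
    then have "ereal C - ereal (C - D) \<le> ereal C - enn2ereal (\<integral>\<^sup>+y. ennreal (?h y) \<partial>?M)"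
      by (intro ereal_minus_mono) auto
    then show ?thesis
      using ext_integral_bounded_above[OF bp usc_fun_measurable[OF bp f], of C] C by simp
  qed
  ultimately show ?thesis using that by blast
qed

end

section \<open>Comparison of the five quantities\<close>

context compact_relation
begin

lemma gamma_le_delta: "erg_gamma X T f \<le> erg_delta X T f"
  unfolding erg_gamma_def
proof (rule SUP_least)
  fix x assume x: "x \<in> orbit_space X T"
  have "birkhoff_avg f x n \<le> (SUP x\<in>finite_orbits X T n. ereal (birkhoff_sum f n x)) / ereal (real n + 1)"
    for n
  proof -
    let ?y = "\<lambda>k\<in>{..n}. x (int k)"
    have "x (int (Suc k)) \<in> T (x (int k))" for k
      using x by (auto simp: orbit_space_def add.commute)
    then have "?y \<in> finite_orbits X T n"
      using x by (auto simp: finite_orbits_def orbit_space_def)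
    moreover have "birkhoff_sum f n ?y = birkhoff_sum f n (\<lambda>k. x (int k))"
      by (simp add: birkhoff_sum_def)
    ultimately have "ereal (birkhoff_sum f n (\<lambda>k. x (int k))) \<le> (SUP x\<in>finite_orbits X T n. ereal (birkhoff_sum f n x))"
      by (metis SUP_upper)
    then have "ereal (birkhoff_sum f n (\<lambda>k. x (int k))) / ereal (real n + 1)
        \<le> (SUP x\<in>finite_orbits X T n. ereal (birkhoff_sum f n x)) / ereal (real n + 1)"
      by (intro ereal_divide_right_mono) auto
    then show ?thesis by (simp add: birkhoff_avg_def)
  qed
  then show "limsup (birkhoff_avg f x) \<le> erg_delta X T f"
    unfolding erg_delta_def by (intro Limsup_mono always_eventually) blast
qed

lemma beta_le_gamma: "erg_beta X T f \<le> erg_gamma X T f"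
  unfolding erg_beta_def
proof (rule SUP_least)
  fix x assume x: "x \<in> Reg X T f"
  then have "lim (birkhoff_avg f x) = limsup (birkhoff_avg f x)"
    by (simp add: Reg_def convergent_limsup_cl)
  also have "\<dots> \<le> erg_gamma X T f"
    unfolding erg_gamma_def using x by (intro SUP_upper) (simp add: Reg_def)
  finally show "lim (birkhoff_avg f x) \<le> erg_gamma X T f" .
qed

lemma epsilon_le_gamma: "erg_epsilon X T f \<le> erg_gamma X T f"
  unfolding erg_epsilon_def
proof (rule SUP_least)
  fix x assume x: "x \<in> orbit_space X T"
  have "(INF n\<in>{1..}. birkhoff_avg f x n) \<le> limsup (birkhoff_avg f x)"
  proof (rule le_Limsup)
    show "\<forall>\<^sub>F n in sequentially. (INF n\<in>{1..}. birkhoff_avg f x n) \<le> birkhoff_avg f x n"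
      using eventually_ge_at_top[of 1] by eventually_elim (auto intro: INF_lower)
  qed simp
  also have "\<dots> \<le> erg_gamma X T f"
    unfolding erg_gamma_def using x by (intro SUP_upper)
  finally show "(INF n\<in>{1..}. birkhoff_avg f x n) \<le> erg_gamma X T f" .
qed

lemma delta_less_infinity:
  assumes f: "usc_fun X f" shows "erg_delta X T f < \<infinity>"
proof -
  obtain C where C: "0 < C" "\<And>x. x \<in> topspace X \<Longrightarrow> f x \<le> C"
    using usc_fun_bounded_above[OF compact f] by blast
  have "(SUP x\<in>finite_orbits X T n. ereal (birkhoff_sum f n x)) / ereal (real n + 1) \<le> ereal C" for n
  proof (intro ereal_divide_le_pos[THEN iffD2] SUP_least)
    fix x assume x: "x \<in> finite_orbits X T n"
    have "birkhoff_sum f n x \<le> (\<Sum>k\<le>n. C)"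
      unfolding birkhoff_sum_def using x C(2) by (intro sum_mono) (auto simp: finite_orbits_def)
    then show "ereal (birkhoff_sum f n x) \<le> ereal (real n + 1) * ereal C"
      by (simp add: algebra_simps)
  qed auto
  then have "erg_delta X T f \<le> ereal C"
    unfolding erg_delta_def by (intro Limsup_bounded always_eventually) blast
  then show ?thesis by (rule le_less_trans) simp
qed

lemma orbit_averages_bounded_below:
  assumes x: "x \<in> orbit_space X T"
    and avg: "\<And>n. (real n + 1) * D \<le> birkhoff_sum f n (\<lambda>k. x (int k))"
  shows "ereal D \<le> birkhoff_avg f x n" and "ereal D \<le> erg_epsilon X T f"
proof -
  show le: "ereal D \<le> birkhoff_avg f x n" for n
    using avg[of n] by (simp add: birkhoff_avg_def le_divide_eq mult.commute)
  have "ereal D \<le> (INF n\<in>{1..}. birkhoff_avg f x n)"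
    by (rule INF_greatest[OF le])
  also have "\<dots> \<le> erg_epsilon X T f"
    unfolding erg_epsilon_def using x by (rule SUP_upper)
  finally show "ereal D \<le> erg_epsilon X T f" .
qed

text \<open>
  The orbit that attains \<open>\<delta>\<close> in the sense of \<open>\<epsilon>\<close> does so
  in the sense of \<open>\<beta>\<close> as well: its averages are bounded below by
  \<open>\<delta>\<close>, while their limit superior is at most
  \<open>\<gamma> \<le> \<delta>\<close>.
\<close>

lemma delta_le:
  assumes f: "usc_fun X f"
  shows "erg_delta X T f \<le> erg_alpha X T f" "erg_delta X T f \<le> erg_beta X T f"
    "erg_delta X T f \<le> erg_epsilon X T f"
proof -
  have "erg_delta X T f \<le> erg_alpha X T f \<and> erg_delta X T f \<le> erg_beta X T f
      \<and> erg_delta X T f \<le> erg_epsilon X T f"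
  proof (cases "erg_delta X T f")
    case (real D)
    then obtain x where x: "x \<in> orbit_space X T"
      and avg: "\<And>n. (real n + 1) * D \<le> birkhoff_sum f n (\<lambda>k. x (int k))"
      using ex_orbit_large_averages[OF f, of D] by auto
    obtain M where M: "M \<in> invariant_measures X T" "ereal D \<le> ext_integral M f"
      using ex_invariant_measure_from_orbit[OF f x avg] by blast
    note le = orbit_averages_bounded_below[OF x avg]
    have "limsup (birkhoff_avg f x) \<le> erg_gamma X T f"
      unfolding erg_gamma_def using x by (rule SUP_upper)
    also have "\<dots> \<le> ereal D" using gamma_le_delta[of f] real by simp
    finally have "limsup (birkhoff_avg f x) \<le> ereal D" .
    moreover have "ereal D \<le> liminf (birkhoff_avg f x)"
      by (intro Liminf_bounded always_eventually allI le(1))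
    ultimately have lim: "birkhoff_avg f x \<longlonglongrightarrow> ereal D"
      using Liminf_le_Limsup[of sequentially "birkhoff_avg f x"]
      by (simp add: tendsto_iff_Liminf_eq_Limsup order_antisym)
    then have "x \<in> Reg X T f" using x by (auto simp: Reg_def convergent_def)
    then have "lim (birkhoff_avg f x) \<le> erg_beta X T f"
      unfolding erg_beta_def by (rule SUP_upper)
    then have "ereal D \<le> erg_beta X T f" using limI[OF lim] by simp
    moreover have "ereal D \<le> erg_alpha X T f"
      unfolding erg_alpha_def using M by (rule SUP_upper2)
    ultimately show ?thesis using real le(2) by simp
  qed (use delta_less_infinity[OF f] in auto)
  then show "erg_delta X T f \<le> erg_alpha X T f" "erg_delta X T f \<le> erg_beta X T f"
    "erg_delta X T f \<le> erg_epsilon X T f" by auto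
qed

end

theorem theorem3p3:
  fixes X :: "'a topology" and T :: "'a \<Rightarrow> 'a set" and f :: "'a \<Rightarrow> real"
  assumes "compact_space X" and "metrizable_space X"
    and "\<forall>x\<in>topspace X. closedin X (T x)"
    and "usc_map X T"
    and "usc_fun X f"
  shows "erg_alpha X T f = erg_beta X T f
      \<and> erg_beta X T f = erg_gamma X T f
      \<and> erg_gamma X T f = erg_delta X T f
      \<and> erg_delta X T f = erg_epsilon X T f
      \<and> erg_alpha X T f \<in> {-\<infinity>..<\<infinity>}
      \<and> (orbit_space X T \<noteq> {} \<and> bounded (f ` topspace X) \<longrightarrow> erg_alpha X T f \<in> range ereal)"
proof -
  interpret compact_relation X T
    by unfold_locales (use assms in auto)
  note f = \<open>usc_fun X f\<close>
  have eq: "erg_alpha X T f = erg_delta X T f" "erg_beta X T f = erg_delta X T f"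
    "erg_gamma X T f = erg_delta X T f" "erg_epsilon X T f = erg_delta X T f"
    using delta_le[OF f] alpha_le_delta[OF f] beta_le_gamma[of f] gamma_le_delta[of f] epsilon_le_gamma[of f]
    by order+
  have lt: "erg_delta X T f < \<infinity>" by (rule delta_less_infinity[OF f])
  have "erg_delta X T f \<in> range ereal" if ne: "orbit_space X T \<noteq> {}" and bdd: "bounded (f ` topspace X)"
  proof -
    obtain x where x: "x \<in> orbit_space X T" using ne by blast
    obtain B where B: "\<And>y. y \<in> topspace X \<Longrightarrow> \<bar>f y\<bar> \<le> B"
      using bdd by (auto simp: bounded_iff)
    have "(real n + 1) * (- B) \<le> birkhoff_sum f n (\<lambda>k. x (int k))" for n
    proof -
      have "(\<Sum>k\<le>n. - B) \<le> birkhoff_sum f n (\<lambda>k. x (int k))"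
        unfolding birkhoff_sum_def
      proof (rule sum_mono)
        fix k
        have "x (int k) \<in> topspace X" using x by (simp add: orbit_space_def)
        then show "- B \<le> f (x (int k))" using B by (metis abs_le_D2 minus_le_iff)
      qed
      then show ?thesis by (simp add: algebra_simps)
    qed
    then have "ereal (- B) \<le> erg_delta X T f"
      using orbit_averages_bounded_below(2)[OF x] eq by metis
    then show ?thesis using lt by (cases "erg_delta X T f") auto
  qed
  then show ?thesis using eq lt by simp
qed

end
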